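(* Let $G$ be a non-periodic group with an abelian normal subgroup $A$ of finite index. Then the following are equivalent: (i) $G$ is a BCF-group; (ii) $G$ is a CF-group and there is a subgroup $B\le A$ such that $B$ has finite exponent, $B$ is normal in $G$, and each $g\in G$ acts by conjugation on $A/B$ by either the identity map or the inversion map.
   Context: A group is periodic if each of its elements has finite order. For $H\le G$, $H_G=\bigcap_{g\in G}H^g$ denotes the normal core of $H$ in $G$. $G$ is a CF-group if $|H:H_G|$ is finite for all $H\le G$; $G$ is a BCF-group if there is $n\in\mathbb{N}$ such that $|H:H_G|\le n$ for all $H\le G$. The inversion map of an abelian group is $x\mapsto x^{-1}$. *)

theory Defs
  imports "HOL-Algebra.Coset" "HOL-Algebra.Multiplicative_Group"
begin

(* group.ord is 0 exactly on the elements of infinite order. *)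
definition periodic_group :: "('a, 'b) monoid_scheme \<Rightarrow> bool" where
  "periodic_group G \<longleftrightarrow> (\<forall>x \<in> carrier G. group.ord G x \<noteq> 0)"

definition conjugate_set :: "('a, 'b) monoid_scheme \<Rightarrow> 'a set \<Rightarrow> 'a \<Rightarrow> 'a set" where
  "conjugate_set G X g = (inv\<^bsub>G\<^esub> g <#\<^bsub>G\<^esub> X) #>\<^bsub>G\<^esub> g"

definition normal_core :: "('a, 'b) monoid_scheme \<Rightarrow> 'a set \<Rightarrow> 'a set" where
  "normal_core G H = (\<Inter>g \<in> carrier G. conjugate_set G H g)"

(* The right cosets of K in H: |H:K| is the cardinality of this set. The index is not
   defined as a number because card is 0 on infinite sets. *)
definition cosets_in :: "('a, 'b) monoid_scheme \<Rightarrow> 'a set \<Rightarrow> 'a set \<Rightarrow> 'a set set" where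
  "cosets_in G H K = rcosets\<^bsub>G\<lparr>carrier := H\<rparr>\<^esub> K"

definition CF_group :: "('a, 'b) monoid_scheme \<Rightarrow> bool" where
  "CF_group G \<longleftrightarrow> group G \<and> (\<forall>H. subgroup H G \<longrightarrow> finite (cosets_in G H (normal_core G H)))"

definition BCF_group :: "('a, 'b) monoid_scheme \<Rightarrow> bool" where
  "BCF_group G \<longleftrightarrow> group G \<and>
     (\<exists>n::nat. \<forall>H. subgroup H G \<longrightarrow>
        finite (cosets_in G H (normal_core G H)) \<and> card (cosets_in G H (normal_core G H)) \<le> n)"

definition finite_exponent :: "('a, 'b) monoid_scheme \<Rightarrow> 'a set \<Rightarrow> bool" where
  "finite_exponent G B \<longleftrightarrow> (\<exists>n::nat. n > 0 \<and> (\<forall>b \<in> B. b [^]\<^bsub>G\<^esub> n = \<one>\<^bsub>G\<^esub>))"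

definition quotient_group :: "('a, 'b) monoid_scheme \<Rightarrow> 'a set \<Rightarrow> 'a set \<Rightarrow> 'a set monoid" where
  "quotient_group G A B = G\<lparr>carrier := A\<rparr> Mod B"

(* For A and B normal in G, the map induced by g on A/B sends the coset B a, as a set,
   to its conjugate, which is the coset of the conjugate of a. *)
definition acts_as_identity :: "('a, 'b) monoid_scheme \<Rightarrow> 'a set \<Rightarrow> 'a set \<Rightarrow> 'a \<Rightarrow> bool" where
  "acts_as_identity G A B g \<longleftrightarrow>
     (\<forall>X \<in> carrier (quotient_group G A B). conjugate_set G X g = X)"

definition acts_as_inversion :: "('a, 'b) monoid_scheme \<Rightarrow> 'a set \<Rightarrow> 'a set \<Rightarrow> 'a \<Rightarrow> bool" where
  "acts_as_inversion G A B g \<longleftrightarrow>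
     (\<forall>X \<in> carrier (quotient_group G A B). conjugate_set G X g = inv\<^bsub>quotient_group G A B\<^esub> X)"

end

theory Submission
  imports Defs "HOL-Computational_Algebra.Primes"
begin

text \<open>
  Suppose first that every index \<open>|H : H\<^sub>G|\<close> is at most \<open>n\<close>, and put \<open>N = n!\<close>. The core of a cyclic
  subgroup \<open>\<langle>a\<rangle>\<close> is \<open>\<langle>a\<^sup>d\<rangle>\<close> for some \<open>d\<close> that divides \<open>N\<close>, so \<open>\<langle>a\<^sup>N\<rangle>\<close> is normal
  (\<open>conj_factorial_power\<close>). Conjugation thus induces on the group \<open>V\<close> of \<open>N\<close>-th powers of
  elements of \<open>A\<close> an automorphism that maps each element to a power of itself. As \<open>G\<close> is not
  periodic and \<open>A\<close> has finite index, \<open>V\<close> contains an element of infinite order, and on such a group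
  only the identity and the inversion have this property (\<open>power_automorphism_sign\<close>). Since
  \<open>A/B \<cong> V\<close> for the group \<open>B\<close> of all \<open>a \<in> A\<close> with \<open>a\<^sup>N = 1\<close>, this \<open>B\<close> is as required.

  Conversely, let \<open>g\<close> act on \<open>A/B\<close> as the power \<open>\<epsilon> = \<plusminus>1\<close>, and let \<open>e\<close> be an exponent of \<open>B\<close>. Then
  \<open>\<psi>(a) = a\<^sup>g a\<^sup>-\<^sup>\<epsilon>\<close> is an endomorphism of \<open>A\<close> whose image has exponent \<open>e\<close>, and \<open>h\<^sup>g \<in> H\<close> holds
  for an element \<open>h\<close> of a subgroup \<open>H\<close> iff \<open>\<psi>(h) \<in> H\<close>. The core of \<open>H \<le> A\<close> is cut out by finitely
  many such conditions, one for each coset of \<open>A\<close>, so it is enough to bound \<open>|\<psi>(H)H : H|\<close> for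
  each \<open>\<psi>\<close> separately. The CF property says that each of these indices is finite, and the point is
  that they are then bounded (\<open>bounded_covering_if_finite_covering\<close>).

  This is shown by constructing, from unbounded indices, a subgroup for which the index is infinite.
  Generators are added one at a time so that their images under \<open>\<psi>\<close> stay pairwise incongruent
  modulo the subgroup \<open>F\<close> generated so far; the differences of images chosen earlier are a finite
  set \<open>X\<close> of elements that the growing subgroup has to avoid. Two facts keep this going. First, the
  indices remain unbounded if only subgroups above \<open>F\<close> are considered: one more generator \<open>a\<close>
  absorbs at most \<open>e\<close> cosets, because a section of exponent \<open>e\<close> of a cyclic group has at most \<open>e\<close>
  elements (\<open>uncovered_above_generate_insert\<close>). Secondly, every \<open>H \<ge> F\<close> contains a subgroup
  \<open>H' \<ge> F\<close> that is disjoint from \<open>X\<close> and such that \<open>|\<psi>(H) : \<psi>(H')|\<close> is bounded in terms of \<open>e\<close> and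
  \<open>|X|\<close>. To avoid a single element \<open>x\<close>, a subgroup \<open>M\<close> is taken that is maximal with \<open>x \<notin> M\<close>. In the
  quotient by \<open>M\<close> every nontrivial subgroup contains the image of \<open>x\<close>, which forces finitely
  generated subgroups of the quotient to be cyclic; so \<open>H/(H \<inter> M)\<close> has at most \<open>e\<close> elements modulo
  \<open>e\<close>-th powers, and \<open>\<psi>\<close> kills \<open>e\<close>-th powers
  (\<open>covered_by_cosets_of_avoiding_subgroup\<close>). If no suitable new generator existed, then \<open>\<psi>(H')\<close>
  would lie in \<open>|Y|\<close> cosets of \<open>H\<close>, where \<open>Y\<close> is the set of images chosen so far, and \<open>\<psi>(H)\<close>
  in a number of cosets that does not depend on \<open>H\<close> (\<open>exists_new_incongruent_image\<close>).
\<close>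

section \<open>Covering a set by boundedly many cosets\<close>

text \<open>For a subgroup \<open>H\<close> this says that \<open>Y\<close> meets at most \<open>n\<close> right cosets of \<open>H\<close>. It is a relation
  instead of a number because only upper bounds get composed, and \<open>card\<close> is \<open>0\<close> on infinite
  sets. The representatives may lie outside \<open>Y\<close>, so that the
  relation is monotone in \<open>Y\<close>.\<close>
definition covered_by_cosets :: "('a, 'b) monoid_scheme \<Rightarrow> nat \<Rightarrow> 'a set \<Rightarrow> 'a set \<Rightarrow> bool" where
  "covered_by_cosets G n Y H \<longleftrightarrow>
     (\<exists>S. S \<subseteq> carrier G \<and> finite S \<and> card S \<le> n \<and> (\<forall>y\<in>Y. \<exists>s\<in>S. y \<otimes>\<^bsub>G\<^esub> inv\<^bsub>G\<^esub> s \<in> H))"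

context group
begin

lemma subgroup_congruent_trans:
  assumes "subgroup H G" "x \<in> carrier G" "y \<in> carrier G" "z \<in> carrier G"
    and "x \<otimes> inv y \<in> H" "z \<otimes> inv y \<in> H"
  shows "x \<otimes> inv z \<in> H"
proof -
  have "(x \<otimes> inv y) \<otimes> inv (z \<otimes> inv y) \<in> H"
    using assms by (simp add: subgroup.m_closed subgroup.m_inv_closed)
  also have "(x \<otimes> inv y) \<otimes> inv (z \<otimes> inv y) = x \<otimes> inv z"
    using assms by (simp add: inv_mult_group m_assoc[symmetric]) (simp add: m_assoc)
  finally show ?thesis .
qed

text \<open>In a coset that meets \<open>Y\<close>, the representative can be exchanged for an element of \<open>Y\<close>; the other
  representatives are dropped.\<close>
lemma covered_by_cosets_reps:
  assumes "covered_by_cosets G n Y H" "subgroup H G" "Y \<subseteq> carrier G"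
  obtains S where "S \<subseteq> Y" "finite S" "card S \<le> n" "\<And>y. y \<in> Y \<Longrightarrow> \<exists>s\<in>S. y \<otimes> inv s \<in> H"
proof -
  obtain S where S: "S \<subseteq> carrier G" "finite S" "card S \<le> n" "\<forall>y\<in>Y. \<exists>s\<in>S. y \<otimes> inv s \<in> H"
    using assms(1) unfolding covered_by_cosets_def by blast
  define S' where "S' = {s \<in> S. \<exists>y\<in>Y. y \<otimes> inv s \<in> H}"
  have "\<forall>s\<in>S'. \<exists>y\<in>Y. y \<otimes> inv s \<in> H" by (simp add: S'_def)
  then obtain r where r: "\<forall>s\<in>S'. r s \<in> Y \<and> r s \<otimes> inv s \<in> H" by metis
  have S': "S' \<subseteq> S" "finite S'" using S(2) by (auto simp: S'_def)
  show ?thesis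
  proof
    show "r ` S' \<subseteq> Y" using r by blast
    show "finite (r ` S')" using S' by blast
    show "card (r ` S') \<le> n"
      using card_image_le[OF S'(2), of r] card_mono[OF S(2) S'(1)] S(3) by linarith
    show "\<exists>s\<in>r ` S'. y \<otimes> inv s \<in> H" if y: "y \<in> Y" for y
    proof -
      obtain s where s: "s \<in> S" "y \<otimes> inv s \<in> H" using S(4) y by blast
      then have sS: "s \<in> S'" using y by (auto simp: S'_def)
      have "y \<otimes> inv (r s) \<in> H"
        using subgroup_congruent_trans[OF assms(2), of y s "r s"] s sS r y assms(3) S(1) by blast
      then show ?thesis using sS by blast
    qed
  qed
qed

lemma covered_by_cosets_mono:
  assumes "covered_by_cosets G m Y H" "m \<le> n" "Y' \<subseteq> Y" "H \<subseteq> H'"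
  shows "covered_by_cosets G n Y' H'"
proof -
  obtain S where S: "S \<subseteq> carrier G" "finite S" "card S \<le> m" "\<forall>y\<in>Y. \<exists>s\<in>S. y \<otimes> inv s \<in> H"
    using assms(1) unfolding covered_by_cosets_def by blast
  have "\<forall>y\<in>Y'. \<exists>s\<in>S. y \<otimes> inv s \<in> H'" using S(4) assms(3,4) by blast
  then show ?thesis
    unfolding covered_by_cosets_def using S(1-3) assms(2) by (intro exI[of _ S]) simp
qed

text \<open>The analogue of multiplicativity of the index.\<close>
lemma covered_by_cosets_trans:
  assumes "covered_by_cosets G m Y K" "covered_by_cosets G n K H" "Y \<subseteq> carrier G"
  shows "covered_by_cosets G (n * m) Y H"
proof -
  obtain S where S: "S \<subseteq> carrier G" "finite S" "card S \<le> m" "\<forall>y\<in>Y. \<exists>s\<in>S. y \<otimes> inv s \<in> K"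
    using assms(1) unfolding covered_by_cosets_def by blast
  obtain U where U: "U \<subseteq> carrier G" "finite U" "card U \<le> n" "\<forall>y\<in>K. \<exists>s\<in>U. y \<otimes> inv s \<in> H"
    using assms(2) unfolding covered_by_cosets_def by blast
  let ?V = "(\<lambda>(u, s). u \<otimes> s) ` (U \<times> S)"
  have "card ?V \<le> card (U \<times> S)" using S(2) U(2) by (intro card_image_le) auto
  also have "\<dots> \<le> n * m" using S(3) U(3) by (simp add: card_cartesian_product mult_le_mono)
  finally have "card ?V \<le> n * m" .
  moreover have "?V \<subseteq> carrier G" "finite ?V" using S(1,2) U(1,2) by auto
  moreover have "\<exists>v\<in>?V. y \<otimes> inv v \<in> H" if y: "y \<in> Y" for y
  proof -
    obtain s where s: "s \<in> S" "y \<otimes> inv s \<in> K" using S(4) y by blast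
    then obtain u where u: "u \<in> U" "(y \<otimes> inv s) \<otimes> inv u \<in> H" using U(4) by blast
    have "(y \<otimes> inv s) \<otimes> inv u = y \<otimes> inv (u \<otimes> s)"
      using s u S(1) U(1) y assms(3) by (simp add: inv_mult_group m_assoc subset_iff)
    then show ?thesis using s u by (intro bexI[of _ "u \<otimes> s"]) auto
  qed
  ultimately show ?thesis unfolding covered_by_cosets_def by blast
qed

lemma covered_by_cosets_image:
  assumes "group K" "f \<in> hom G K" "covered_by_cosets G n Y H" "Y \<subseteq> carrier G"
  shows "covered_by_cosets K n (f ` Y) (f ` H)"
proof -
  interpret f: group_hom G K f
    using assms by (simp add: group_hom_def group_hom_axioms_def is_group)
  obtain S where S: "S \<subseteq> carrier G" "finite S" "card S \<le> n" "\<forall>y\<in>Y. \<exists>s\<in>S. y \<otimes> inv s \<in> H"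
    using assms(3) unfolding covered_by_cosets_def by blast
  have "\<exists>s\<in>f ` S. f y \<otimes>\<^bsub>K\<^esub> inv\<^bsub>K\<^esub> s \<in> f ` H" if y: "y \<in> Y" for y
  proof -
    obtain s where s: "s \<in> S" "y \<otimes> inv s \<in> H" using S(4) y by blast
    then have "f y \<otimes>\<^bsub>K\<^esub> inv\<^bsub>K\<^esub> (f s) = f (y \<otimes> inv s)"
      using y assms(4) S(1) by (simp add: subset_iff)
    then show ?thesis using s by auto
  qed
  moreover have "card (f ` S) \<le> n" using card_image_le[OF S(2)] S(3) le_trans by blast
  ultimately show ?thesis unfolding covered_by_cosets_def using S(1,2)
    by (intro exI[of _ "f ` S"]) auto
qed

text \<open>The map \<open>f\<close> induces an injection from the cosets of the preimage of \<open>L\<close> in \<open>Y\<close> into the cosets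
  of \<open>L\<close> that meet \<open>f ` Y\<close>. With \<open>f = id\<close> this bounds the index of an intersection.\<close>
lemma covered_by_cosets_preimage:
  assumes "subgroup Y G" "group K" "f \<in> hom G K" "subgroup L K" "covered_by_cosets K n (f ` Y) L"
  shows "covered_by_cosets G n Y {y \<in> Y. f y \<in> L}"
proof -
  interpret f: group_hom G K f
    using assms by (simp add: group_hom_def group_hom_axioms_def is_group)
  interpret Y: subgroup Y G by fact
  obtain S where S: "S \<subseteq> f ` Y" "finite S" "card S \<le> n"
      "\<And>y. y \<in> f ` Y \<Longrightarrow> \<exists>s\<in>S. y \<otimes>\<^bsub>K\<^esub> inv\<^bsub>K\<^esub> s \<in> L"
    using group.covered_by_cosets_reps[OF assms(2,5,4)] f.hom_closed Y.subset by blast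
  have "\<forall>s\<in>S. \<exists>y. y \<in> Y \<and> f y = s" using S(1) by blast
  then obtain r where r: "\<forall>s\<in>S. r s \<in> Y \<and> f (r s) = s" by (rule bchoice[THEN exE])
  have "\<exists>s\<in>r ` S. y \<otimes> inv s \<in> {y \<in> Y. f y \<in> L}" if y: "y \<in> Y" for y
  proof -
    obtain s where s: "s \<in> S" "f y \<otimes>\<^bsub>K\<^esub> inv\<^bsub>K\<^esub> s \<in> L" using S(4) y by blast
    then have "y \<otimes> inv (r s) \<in> {y \<in> Y. f y \<in> L}" using r y by auto
    then show ?thesis using s by blast
  qed
  moreover have "card (r ` S) \<le> n" using card_image_le[OF S(2)] S(3) le_trans by blast
  ultimately show ?thesis unfolding covered_by_cosets_def using r S(2) Y.subset
    by (intro exI[of _ "r ` S"]) auto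
qed

lemma card_le_if_covered_by_cosets:
  assumes "covered_by_cosets G n Y H" "subgroup H G" "Y \<subseteq> carrier G"
    and "T \<subseteq> Y" "\<And>s t. \<lbrakk>s \<in> T; t \<in> T; s \<noteq> t\<rbrakk> \<Longrightarrow> s \<otimes> inv t \<notin> H"
  shows "finite T \<and> card T \<le> n"
proof -
  obtain S where S: "S \<subseteq> carrier G" "finite S" "card S \<le> n" "\<forall>y\<in>Y. \<exists>s\<in>S. y \<otimes> inv s \<in> H"
    using assms(1) unfolding covered_by_cosets_def by blast
  obtain r where r: "\<forall>y\<in>Y. r y \<in> S \<and> y \<otimes> inv (r y) \<in> H" using S(4) by metis
  have "inj_on r T"
  proof (rule inj_onI, rule ccontr)
    fix s t assume st: "s \<in> T" "t \<in> T" "r s = r t" "s \<noteq> t"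
    have "s \<otimes> inv t \<in> H"
      using subgroup_congruent_trans[OF assms(2), of s "r s" t] st r assms(3,4) S(1)
      by (metis subsetD)
    then show False using assms(5) st by blast
  qed
  moreover have "r ` T \<subseteq> S" using r assms(4) by blast
  ultimately show ?thesis using S(2,3) by (meson card_inj_on_le finite_imageD finite_subset le_trans)
qed

text \<open>A largest pairwise incongruent subset of \<open>Y\<close> is a set of representatives.\<close>
lemma covered_by_cosets_if_no_incongruent_set:
  assumes "subgroup H G" "Y \<subseteq> carrier G"
    and "\<And>T. \<lbrakk>T \<subseteq> Y; finite T; card T = Suc n\<rbrakk> \<Longrightarrow> \<exists>s\<in>T. \<exists>t\<in>T. s \<noteq> t \<and> s \<otimes> inv t \<in> H"
  shows "covered_by_cosets G n Y H"
proof -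
  define P where
    "P = (\<lambda>T. T \<subseteq> Y \<and> finite T \<and> (\<forall>s\<in>T. \<forall>t\<in>T. s \<noteq> t \<longrightarrow> s \<otimes> inv t \<notin> H))"
  have bound: "card T \<le> n" if "P T" for T
  proof (rule ccontr)
    assume "\<not> card T \<le> n"
    then obtain T' where "T' \<subseteq> T" "card T' = Suc n"
      by (meson not_less_eq_eq obtain_subset_with_card_n)
    then show False using assms(3)[of T'] that unfolding P_def by (meson finite_subset subset_iff)
  qed
  have "P {}" by (simp add: P_def)
  then obtain T where T: "P T" "\<And>T'. P T' \<Longrightarrow> card T' \<le> card T"
    using ex_has_greatest_nat[of P "{}" card "Suc n"] bound le_imp_less_Suc by metis
  have "\<exists>s\<in>T. y \<otimes> inv s \<in> H" if y: "y \<in> Y" for y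
  proof (rule ccontr)
    assume neg: "\<not> ?thesis"
    have "y \<notin> T"
      using neg y assms(1,2) subgroup.one_closed[OF assms(1)] by (metis r_inv subsetD)
    moreover have "t \<otimes> inv y \<notin> H" if "t \<in> T" for t
    proof
      assume "t \<otimes> inv y \<in> H"
      then have "inv (t \<otimes> inv y) \<in> H" using assms(1) by (simp add: subgroup.m_inv_closed)
      moreover have "inv (t \<otimes> inv y) = y \<otimes> inv t"
        using that y T(1) assms(2) by (auto simp: P_def inv_mult_group subset_iff)
      ultimately show False using neg that by auto
    qed
    ultimately have "P (insert y T)" using T(1) neg y by (auto simp: P_def)
    then have "card (insert y T) \<le> card T" by (rule T(2))
    then show False using \<open>y \<notin> T\<close> T(1) by (simp add: P_def)
  qed
  then show ?thesis
    unfolding covered_by_cosets_def using T(1) bound[OF T(1)] assms(2)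
    by (intro exI[of _ T]) (auto simp: P_def)
qed

text \<open>Two of the \<open>n + 1\<close> powers \<open>x\<^sup>0, \<dots>, x\<^sup>n\<close> lie in the same coset.\<close>
lemma exists_power_in_if_covered_by_cosets:
  assumes "covered_by_cosets G n Y H" "subgroup H G" "x \<in> carrier G" "\<And>i::nat. x [^] i \<in> Y"
  obtains d where "0 < d" "d \<le> n" "x [^] d \<in> H"
proof -
  obtain S where S: "S \<subseteq> carrier G" "finite S" "card S \<le> n" "\<forall>y\<in>Y. \<exists>s\<in>S. y \<otimes> inv s \<in> H"
    using assms(1) unfolding covered_by_cosets_def by blast
  have "\<forall>i::nat. \<exists>s\<in>S. x [^] i \<otimes> inv s \<in> H" using S(4) assms(4) by blast
  then obtain r where r: "\<And>i::nat. r i \<in> S" "\<And>i. x [^] i \<otimes> inv (r i) \<in> H" by metis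
  have "\<not> inj_on r {..n}"
  proof
    assume "inj_on r {..n}"
    moreover have "r ` {..n} \<subseteq> S" using r(1) by blast
    ultimately have "card {..n} \<le> card S" using card_inj_on_le S(2) by blast
    then show False using S(3) by simp
  qed
  then obtain i j where "i \<le> n" "j \<le> n" "i \<noteq> j" "r i = r j" by (auto simp: inj_on_def)
  then obtain i j where ij: "i < j" "j \<le> n" "r i = r j" by (metis linorder_neqE_nat)
  have "x [^] j \<otimes> inv (x [^] i) \<in> H"
    using subgroup_congruent_trans[OF assms(2), of "x [^] j" "r j" "x [^] i"] r ij(3) S(1) assms(3)
    by (metis nat_pow_closed subsetD)
  moreover have "x [^] j = x [^] (j - i) \<otimes> x [^] i" using ij assms(3) by (simp add: nat_pow_mult)
  ultimately have "x [^] (j - i) \<in> H" using assms(3) by (simp add: m_assoc)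
  then show ?thesis using ij by (intro that[of "j - i"]) auto
qed

text \<open>The link to the indices in the definitions of CF- and BCF-groups.\<close>
lemma cosets_in_card_iff:
  assumes "subgroup H G" "subgroup K G" "K \<subseteq> H"
  shows "finite (cosets_in G H K) \<and> card (cosets_in G H K) \<le> n \<longleftrightarrow> covered_by_cosets G n H K"
proof -
  interpret H: subgroup H G by fact
  interpret K: subgroup K G by fact
  have eq: "cosets_in G H K = (\<lambda>h. K #> h) ` H"
    unfolding cosets_in_def RCOSETS_def by (auto simp: r_coset_def)
  have cong: "K #> x = K #> y \<longleftrightarrow> x \<otimes> inv y \<in> K" if "x \<in> carrier G" "y \<in> carrier G" for x y
    by (metis K.rcos_module repr_independence rcos_self K.subgroup_axioms that is_group)
  show ?thesis
  proof
    assume *: "finite (cosets_in G H K) \<and> card (cosets_in G H K) \<le> n"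
    then obtain S where S: "S \<subseteq> H" "inj_on (\<lambda>h. K #> h) S" "(\<lambda>h. K #> h) ` H = (\<lambda>h. K #> h) ` S"
      using subset_image_inj[of "(\<lambda>h. K #> h) ` H" "\<lambda>h. K #> h" H] by auto
    then have "finite S" using * eq finite_imageD[OF _ S(2)] by simp
    moreover have "card S \<le> n" using * eq S(3) card_image[OF S(2)] by simp
    moreover have "\<exists>s\<in>S. h \<otimes> inv s \<in> K" if "h \<in> H" for h
    proof -
      have "K #> h \<in> (\<lambda>h. K #> h) ` S" unfolding S(3)[symmetric] using that by (rule imageI)
      then obtain s where s: "s \<in> S" "K #> h = K #> s" by (rule imageE)
      then have "h \<otimes> inv s \<in> K" using cong[of h s] that S(1) H.subset by (simp add: subset_iff)
      then show ?thesis using s(1) by blast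
    qed
    ultimately show "covered_by_cosets G n H K"
      unfolding covered_by_cosets_def using subset_trans[OF S(1) H.subset]
      by (intro exI[of _ S]) simp
  next
    assume "covered_by_cosets G n H K"
    then obtain S where S: "S \<subseteq> carrier G" "finite S" "card S \<le> n" "\<forall>h\<in>H. \<exists>s\<in>S. h \<otimes> inv s \<in> K"
      unfolding covered_by_cosets_def by blast
    have "cosets_in G H K \<subseteq> (\<lambda>h. K #> h) ` S"
    proof
      fix C assume "C \<in> cosets_in G H K"
      then obtain h where h: "h \<in> H" "C = K #> h" unfolding eq by blast
      then obtain s where s: "s \<in> S" "h \<otimes> inv s \<in> K" using S(4) by blast
      then have "C = K #> s" using cong[of h s] h S(1) by (simp add: subset_iff)
      then show "C \<in> (\<lambda>h. K #> h) ` S" using s(1) by blast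
    qed
    then show "finite (cosets_in G H K) \<and> card (cosets_in G H K) \<le> n"
      using S(3) card_image_le[OF S(2), of "\<lambda>h. K #> h"] finite_imageI[OF S(2), of "\<lambda>h. K #> h"]
      by (meson card_mono finite_subset le_trans)
  qed
qed

text \<open>Lets results on abelian groups be applied to \<open>A\<close> as a group in its own right.\<close>
lemma covered_by_cosets_subgroup_iff:
  assumes "subgroup A G" "Y \<subseteq> A" "subgroup H G" "H \<subseteq> A"
  shows "covered_by_cosets (G\<lparr>carrier := A\<rparr>) n Y H \<longleftrightarrow> covered_by_cosets G n Y H"
proof
  interpret A: subgroup A G by fact
  assume "covered_by_cosets (G\<lparr>carrier := A\<rparr>) n Y H"
  then obtain S where S: "S \<subseteq> A" "finite S" "card S \<le> n"
    "\<forall>y\<in>Y. \<exists>s\<in>S. y \<otimes> inv\<^bsub>G\<lparr>carrier := A\<rparr>\<^esub> s \<in> H"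
    unfolding covered_by_cosets_def by auto
  then have "\<forall>y\<in>Y. \<exists>s\<in>S. y \<otimes> inv s \<in> H" using m_inv_consistent[OF assms(1)] by (metis subsetD)
  then show "covered_by_cosets G n Y H"
    unfolding covered_by_cosets_def using S A.subset by (intro exI[of _ S]) auto
next
  assume *: "covered_by_cosets G n Y H"
  have "Y \<subseteq> carrier G" using assms(1,2) subgroup.subset by blast
  then obtain S where S: "S \<subseteq> Y" "finite S" "card S \<le> n" "\<And>y. y \<in> Y \<Longrightarrow> \<exists>s\<in>S. y \<otimes> inv s \<in> H"
    using covered_by_cosets_reps[OF * assms(3)] by blast
  then have "\<forall>y\<in>Y. \<exists>s\<in>S. y \<otimes> inv\<^bsub>G\<lparr>carrier := A\<rparr>\<^esub> s \<in> H"
    using m_inv_consistent[OF assms(1)] assms(2) by (metis subsetD)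
  then show "covered_by_cosets (G\<lparr>carrier := A\<rparr>) n Y H"
    unfolding covered_by_cosets_def using S assms(2) by (intro exI[of _ S]) auto
qed

lemma covered_by_cosets_intersection:
  assumes "subgroup H G" "subgroup A G" "covered_by_cosets G n (carrier G) A"
  shows "covered_by_cosets G n H (H \<inter> A)"
proof -
  have "covered_by_cosets G n (id ` H) A"
    using covered_by_cosets_mono[OF assms(3)] subgroup.subset[OF assms(1)] by auto
  moreover have "id \<in> hom G G" by (simp add: hom_def)
  ultimately have "covered_by_cosets G n H {y \<in> H. id y \<in> A}"
    using covered_by_cosets_preimage[OF assms(1) is_group _ assms(2)] by blast
  then show ?thesis by (simp add: Int_def)
qed

end

section \<open>Cyclic extensions and sections of bounded exponent\<close>

lemma int_ideal_principal:
  fixes D :: "int set"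
  assumes "k \<in> D" and D: "\<And>k l q. \<lbrakk>k \<in> D; l \<in> D\<rbrakk> \<Longrightarrow> k - l * q \<in> D"
  obtains d where "d \<in> D" "\<And>k. k \<in> D \<Longrightarrow> d dvd k"
proof -
  have D0: "0 \<in> D" using D[OF assms(1,1), of 1] by simp
  show ?thesis
  proof (cases "\<exists>k\<in>D. k \<noteq> 0")
    case True
    then obtain k where k: "k \<in> D" "k \<noteq> 0" by blast
    have "- k \<in> D" using D[OF D0 k(1), of 1] by simp
    then have "int (nat \<bar>k\<bar>) \<in> D \<and> nat \<bar>k\<bar> > 0" using k by (simp add: abs_if)
    then have ex: "\<exists>n. n > 0 \<and> int n \<in> D" by blast
    define d where "d = (LEAST n. n > 0 \<and> int n \<in> D)"
    have d: "d > 0" "int d \<in> D" using LeastI_ex[OF ex] by (auto simp: d_def)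
    have "int d dvd l" if l: "l \<in> D" for l
    proof (rule ccontr)
      assume "\<not> int d dvd l"
      then have pos: "l mod int d > 0"
        using d(1) by (metis dvd_eq_mod_eq_0 of_nat_0_less_iff order_le_less pos_mod_sign)
      moreover have "l mod int d \<in> D"
        using D[OF l d(2), of "l div int d"] by (simp add: minus_mult_div_eq_mod)
      ultimately have "d \<le> nat (l mod int d)" unfolding d_def by (intro Least_le) auto
      moreover have "l mod int d < int d" using d(1) by simp
      ultimately show False using pos by linarith
    qed
    then show ?thesis using d(2) that by blast
  next
    case False
    then show ?thesis using D0 that by fastforce
  qed
qed

context comm_group
begin

lemma generate_insert_eq:
  assumes "subgroup H G" "a \<in> carrier G"
  shows "generate G (insert a H) = {h \<otimes> a [^] (k::int) | h k. h \<in> H}" (is "_ = ?R")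
proof
  interpret H: subgroup H G by fact
  have gen: "generate G (insert a H) \<subseteq> carrier G" "subgroup (generate G (insert a H)) G"
    using assms(2) H.subset by (auto intro!: generate_incl generate_is_subgroup)
  have "subgroup ?R G"
  proof (rule subgroupI)
    show "?R \<subseteq> carrier G" using assms(2) by auto
    have "\<one> \<otimes> a [^] (0::int) \<in> ?R" using H.one_closed by blast
    then show "?R \<noteq> {}" by blast
    fix x y assume "x \<in> ?R" "y \<in> ?R"
    then obtain h k h' k' where *: "x = h \<otimes> a [^] (k::int)" "h \<in> H" "y = h' \<otimes> a [^] (k'::int)" "h' \<in> H"
      by blast
    have "inv x = inv h \<otimes> a [^] (- k)" using * assms(2) by (simp add: inv_mult int_pow_neg)
    then show "inv x \<in> ?R" using * by blast
    have "x \<otimes> y = (h \<otimes> h') \<otimes> a [^] (k + k')" using * assms(2)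
      by (simp add: int_pow_mult m_ac)
    then show "x \<otimes> y \<in> ?R" using * by blast
  qed
  moreover have "insert a H \<subseteq> ?R"
  proof -
    have "a = \<one> \<otimes> a [^] (1::int)" using assms(2) by simp
    then have "a \<in> ?R" using H.one_closed by blast
    moreover have "h \<in> ?R" if "h \<in> H" for h
      using that assms(2) by (force intro!: exI[of _ h] exI[of _ "0::int"])
    ultimately show ?thesis by blast
  qed
  ultimately show "generate G (insert a H) \<subseteq> ?R" by (rule generate_subgroup_incl[rotated])
  have "a \<in> generate G (insert a H)" "H \<subseteq> generate G (insert a H)"
    by (auto intro: generate.incl)
  then show "?R \<subseteq> generate G (insert a H)"
    using gen(2) by (auto intro!: subgroup.m_closed subgroup_int_pow_closed)
qed

text \<open>Modulo \<open>H\<close>, the elements of \<open>\<langle>H, a\<rangle>\<close> whose \<open>e\<close>-th power lies in \<open>H\<close> form a subgroup of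
  exponent \<open>e\<close> of the cyclic group \<open>\<langle>H, a\<rangle>/H\<close>, and such a subgroup has at most \<open>e\<close> elements.\<close>
lemma covered_bounded_exponent_cyclic_extension:
  assumes "subgroup H G" "a \<in> carrier G" "0 < e" "Y \<subseteq> generate G (insert a H)"
    and "\<And>y. y \<in> Y \<Longrightarrow> y [^] (e::nat) \<in> H"
  shows "covered_by_cosets G e Y H"
proof -
  interpret H: subgroup H G by fact
  define D where "D = {k::int. a [^] (k * int e) \<in> H}"
  have D_diff: "k - l * q \<in> D" if "k \<in> D" "l \<in> D" for k l q
  proof -
    have "(k - l * q) * int e = k * int e - (l * int e) * q" by (simp add: algebra_simps)
    then have "a [^] ((k - l * q) * int e) = a [^] (k * int e) \<otimes> inv ((a [^] (l * int e)) [^] q)"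
      using assms(2) by (simp only: int_pow_diff int_pow_pow)
    then show ?thesis
      using that assms(1) subgroup_int_pow_closed unfolding D_def by auto
  qed
  have "0 \<in> D" by (simp add: D_def)
  then obtain d where d: "d \<in> D" "\<And>k. k \<in> D \<Longrightarrow> d dvd k"
    using int_ideal_principal D_diff by blast
  let ?S = "(\<lambda>j. a [^] (d * int j)) ` {..<e}"
  have "\<exists>s\<in>?S. y \<otimes> inv s \<in> H" if y: "y \<in> Y" for y
  proof -
    obtain h k where hk: "h \<in> H" "y = h \<otimes> a [^] (k::int)"
      using y assms(4) generate_insert_eq[OF assms(1,2)] by blast
    have ye: "y [^] e = h [^] e \<otimes> a [^] (k * int e)"
      using hk assms(2) by (simp add: int_pow_distrib int_pow_pow flip: int_pow_int)
    have he: "h [^] e \<in> H"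
      using hk(1) subgroup_int_pow_closed[OF assms(1), of h "int e"] by (simp add: int_pow_int)
    have "inv (h [^] e) \<otimes> y [^] e \<in> H" using assms(5)[OF y] he by blast
    also have "inv (h [^] e) \<otimes> y [^] e = a [^] (k * int e)"
      using ye hk assms(2) by (simp flip: m_assoc)
    finally have kD: "k \<in> D" by (simp add: D_def)
    then obtain q where q: "k = d * q" using d(2) by blast
    obtain j where j: "j < e" and qe: "q = int e * (q div int e) + int j"
      using assms(3) by (intro that[of "nat (q mod int e)"]) (auto simp: nat_less_iff)
    have "k - d * int j = (d * int e) * (q div int e)"
      using qe q by (metis add_diff_cancel_right' distrib_left mult.assoc)
    then have "a [^] (k - d * int j) = (a [^] (d * int e)) [^] (q div int e)"
      using assms(2) by (simp add: int_pow_pow)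
    also have "\<dots> \<in> H"
      using d(1) by (auto simp: D_def intro: subgroup_int_pow_closed[OF assms(1)])
    finally have "h \<otimes> a [^] (k - d * int j) \<in> H" using hk(1) by blast
    moreover have "h \<otimes> a [^] (k - d * int j) = y \<otimes> inv (a [^] (d * int j))"
      using hk assms(2) by (simp add: int_pow_diff m_assoc)
    ultimately show ?thesis using j by (intro bexI[of _ "a [^] (d * int j)"]) auto
  qed
  moreover have "card ?S \<le> e" using card_image_le[of "{..<e}"] by (metis card_lessThan finite_lessThan)
  ultimately show ?thesis
    unfolding covered_by_cosets_def using assms(2) by (intro exI[of _ ?S]) auto
qed

end

section \<open>Abelian groups with a smallest nontrivial subgroup\<close>

lemma eq_prime_power_if_unique_prime_divisor:
  fixes n p :: nat
  assumes "0 < n" "\<And>q. \<lbrakk>prime q; q dvd n\<rbrakk> \<Longrightarrow> q = p"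
  shows "\<exists>a. n = p ^ a"
  using assms
proof (induction n rule: less_induct)
  case (less n)
  show ?case
  proof (cases "n = 1")
    case True
    then show ?thesis by (intro exI[of _ 0]) simp
  next
    case False
    then obtain q where q: "prime q" "q dvd n" using prime_factor_nat by blast
    then have "q = p" using less.prems(2) by blast
    then obtain m where m: "n = p * m" using q(2) by blast
    have "prime p" using q \<open>q = p\<close> by simp
    have "0 < m" "m < n" using m less.prems(1) prime_gt_1_nat[OF \<open>prime p\<close>] by auto
    moreover have "r = p" if "prime r" "r dvd m" for r using less.prems(2)[of r] that m by auto
    ultimately obtain a where "m = p ^ a" using less.IH[of m] by blast
    then show ?thesis using m by (intro exI[of _ "Suc a"]) simp
  qed
qed

context comm_group
begin

text \<open>Here \<open>x\<close> lies in every nontrivial subgroup. Then every element has finite order: otherwise the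
  same would hold for \<open>x\<close>, which is impossible as \<open>x\<close> is a power of \<open>x\<^sup>2\<close>. If a prime
  \<open>q\<close> divides the order of \<open>u\<close>, then \<open>\<langle>u\<rangle>\<close> has a subgroup of order \<open>q\<close>; it contains \<open>x\<close>, so
  that \<open>q\<close> is the order of \<open>x\<close>. Hence all orders are powers of one prime \<open>p\<close>, and of any two orders
  one divides the other. If \<open>ord v\<close> divides \<open>ord u\<close>, then \<open>v \<in> \<langle>u\<rangle>\<close>: as \<open>\<langle>u\<rangle>\<close> and \<open>\<langle>v\<rangle>\<close> have
  the same subgroup \<open>\<langle>x\<rangle>\<close> of order \<open>p\<close>, multiplying \<open>v\<close> by a power of \<open>u\<close> lowers its
  order, and induction applies.\<close>
lemma cyclic_subgroups_chain_if_monolithic: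
  assumes x: "x \<in> carrier G" "x \<noteq> \<one>"
    and mono: "\<And>y. \<lbrakk>y \<in> carrier G; y \<noteq> \<one>\<rbrakk> \<Longrightarrow> \<exists>k::int. x = y [^] k"
    and yz: "y \<in> carrier G" "z \<in> carrier G"
  shows "(\<exists>k::int. z = y [^] k) \<or> (\<exists>k::int. y = z [^] k)"
proof -
  have "ord x \<noteq> 0"
  proof (cases "x [^] (2::nat) = \<one>")
    case True
    then show ?thesis using x(1) pow_eq_id[of x 2] by (metis dvd_0_left_iff zero_neq_numeral)
  next
    case False
    then obtain k :: int where "x = (x [^] (2::nat)) [^] k" using mono[of "x [^] (2::nat)"] x by auto
    then have "x [^] (1::int) = x [^] (2 * k)"
      using x(1) int_pow_pow[OF x(1), of 2 k] int_pow_int[of G x 2] by simp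
    then have *: "int (ord x) dvd 2 * k - 1" using int_pow_eq[OF x(1), of 1 "2 * k"] by simp
    show ?thesis
    proof
      assume "ord x = 0"
      with * have "2 * k - 1 = 0" by simp
      then show False by presburger
    qed
  qed
  have ord_pos: "0 < ord u" if u: "u \<in> carrier G" for u
  proof (cases "u = \<one>")
    case False
    then obtain k :: int where k: "x = u [^] k" using mono u by blast
    have "x [^] int (ord x) = \<one>" using x(1) by (simp add: int_pow_int)
    then have "u [^] (k * int (ord x)) = \<one>" using u k by (simp add: int_pow_pow)
    then have "int (ord u) dvd k * int (ord x)" using int_pow_eq_id u by blast
    moreover have "k \<noteq> 0" using k x(2) by auto
    ultimately show ?thesis using \<open>ord x \<noteq> 0\<close> by (intro gr0I) simp
  next
    case True
    then show ?thesis using ord_id by simp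
  qed
  have ord_prime_part: "ord (u [^] (ord u div q)) = q" if u: "u \<in> carrier G" "q dvd ord u" for u q
  proof -
    obtain m where m: "ord u = q * m" using u(2) by blast
    then have "q \<noteq> 0" "m \<noteq> 0" using ord_pos[OF u(1)] by auto
    then show ?thesis using ord_pow[of u m] u(1) m by simp
  qed
  have x_in_prime_part: "\<exists>k::int. x = (u [^] (ord u div q)) [^] k"
    if "u \<in> carrier G" "prime q" "q dvd ord u" for u q
  proof (rule mono)
    have "ord (u [^] (ord u div q)) = q" using ord_prime_part that by blast
    then show "u [^] (ord u div q) \<noteq> \<one>" using that(2) by (metis not_prime_1 ord_id)
  qed (use that in simp)
  have ord_x: "ord x = q" if u: "u \<in> carrier G" "prime q" "q dvd ord u" for u q
  proof -
    let ?v = "u [^] (ord u div q)"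
    obtain k :: int where k: "x = ?v [^] k" using x_in_prime_part u by blast
    have "?v [^] int q = \<one>" using ord_prime_part[OF u(1,3)] u(1) int_pow_eq_id[of ?v "int q"] by simp
    then have "x [^] int q = \<one>" using k u(1) by (metis int_pow_one int_pow_pow mult.commute nat_pow_closed)
    then have "ord x dvd q" using x(1) pow_eq_id[of x q] by (simp add: int_pow_int)
    moreover have "ord x \<noteq> 1" using ord_eq_1 x by blast
    ultimately show ?thesis using u(2) by (metis One_nat_def prime_nat_iff)
  qed
  have cyc: "\<exists>k::int. v = u [^] k" if "u \<in> carrier G" "v \<in> carrier G" "ord v dvd ord u" for u v
    using that
  proof (induction "ord v" arbitrary: v rule: less_induct)
    case less
    show ?case
    proof (cases "v = \<one>")
      case True
      then show ?thesis by (intro exI[of _ 0]) simp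
    next
      case False
      then have "ord v \<noteq> 1" using ord_eq_1 less.prems by blast
      then obtain p where p: "prime p" "p dvd ord v" using prime_factor_nat by blast
      then obtain m where m: "ord v = p * m" by blast
      obtain r where r: "ord u = p * m * r" using less.prems(3) m by auto
      have "p > 0" using p(1) prime_gt_0_nat by blast
      let ?v0 = "v [^] m" and ?u0 = "u [^] (m * r)"
      have eqs: "ord v div p = m" "ord u div p = m * r" using m r \<open>p > 0\<close> by simp_all
      have ord_v0: "ord ?v0 = p" using ord_prime_part[OF less.prems(2) p(2)] eqs by simp
      obtain i :: int where i: "x = ?v0 [^] i" using x_in_prime_part[OF less.prems(2) p] eqs by auto
      obtain j :: int where j: "x = ?u0 [^] j"
        using x_in_prime_part[OF less.prems(1) p(1)] eqs r by auto
      have "\<not> int p dvd i"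
        using i x(2) int_pow_eq_id[of ?v0 i] less.prems(2) ord_v0 by auto
      then have "coprime (int p) i" using p(1) by (simp add: prime_imp_coprime)
      \<comment> \<open>The element \<open>x\<close> generates the subgroup of order \<open>p\<close> of \<open>\<langle>v\<rangle>\<close>, so \<open>v\<^sup>m\<close> is a power of \<open>x\<close>,
        and \<open>i'\<close> is the exponent.\<close>
      then obtain c i' where "c * int p + i' * i = 1"
        using bezout_int[of "int p" i] by auto
      then have "i * i' - 1 = int p * (- c)" by (simp add: algebra_simps)
      then have "int p dvd i * i' - 1" by simp
      then have "?v0 [^] (1::int) = ?v0 [^] (i * i')"
        using int_pow_eq[of ?v0 1 "i * i'"] less.prems(2) ord_v0 by (metis nat_pow_closed)
      then have v0: "?v0 = ?u0 [^] (j * i')"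
        using i j less.prems by (metis int_pow_1 int_pow_pow nat_pow_closed)
      \<comment> \<open>The power of \<open>u\<close> is the one whose \<open>m\<close>-th power equals \<open>v\<^sup>m\<close>.\<close>
      let ?w = "v \<otimes> inv (u [^] (int r * (j * i')))"
      have "?u0 [^] (j * i') = (u [^] (int r * (j * i'))) [^] int m"
      proof -
        have "int (m * r) * (j * i') = int r * (j * i') * int m" by simp
        then show ?thesis
          using less.prems(1) int_pow_pow by (metis int_pow_int)
      qed
      then have "?w [^] m = \<one>"
        using v0 less.prems(1,2)
        by (simp add: nat_pow_distrib nat_pow_inv int_pow_int)
      then have dvd_m: "ord ?w dvd m" using pow_eq_id less.prems(1,2) by simp
      have "m < ord v" "0 < m"
        using m ord_pos[OF less.prems(2)] prime_gt_1_nat[OF p(1)] by auto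
      then have "ord ?w < ord v" using dvd_imp_le[OF dvd_m] by simp
      moreover have "ord ?w dvd ord u" using dvd_m r by (simp add: dvd_mult2 dvd_mult)
      ultimately obtain k :: int where k: "?w = u [^] k"
        using less.hyps[of ?w] less.prems(1,2) by auto
      have "v = ?w \<otimes> u [^] (int r * (j * i'))" using less.prems(1,2) by (simp add: m_assoc)
      then have "v = u [^] (k + int r * (j * i'))"
        unfolding k using less.prems(1) by (simp add: int_pow_mult)
      then show ?thesis by blast
    qed
  qed
  have pp: "\<exists>a. ord u = ord x ^ a" if "u \<in> carrier G" for u
    using eq_prime_power_if_unique_prime_divisor[of "ord u" "ord x"] ord_pos[OF that] ord_x[OF that] by auto
  obtain a b where "ord y = ord x ^ a" "ord z = ord x ^ b" using pp yz by meson
  then have "ord y dvd ord z \<or> ord z dvd ord y" by (metis le_imp_power_dvd linear)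
  then show ?thesis using cyc yz by blast
qed

section \<open>Subgroups that avoid finitely many elements\<close>

lemma exists_maximal_subgroup_avoiding:
  assumes "subgroup F G" "x \<notin> F"
  obtains M where "subgroup M G" "F \<subseteq> M" "x \<notin> M"
    "\<And>N. \<lbrakk>subgroup N G; M \<subset> N\<rbrakk> \<Longrightarrow> x \<in> N"
proof -
  define \<A> where "\<A> = {M. subgroup M G \<and> F \<subseteq> M \<and> x \<notin> M}"
  have "\<exists>M\<in>\<A>. \<forall>X\<in>\<A>. M \<subseteq> X \<longrightarrow> X = M"
  proof (rule subset_Zorn_nonempty)
    show "\<A> \<noteq> {}" using assms by (auto simp: \<A>_def)
    fix \<C> assume C: "\<C> \<noteq> {}" "subset.chain \<A> \<C>"
    then have sub: "\<C> \<subseteq> \<A>" and lin: "\<And>X Y. \<lbrakk>X \<in> \<C>; Y \<in> \<C>\<rbrakk> \<Longrightarrow> X \<subseteq> Y \<or> Y \<subseteq> X"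
      by (auto simp: subset_chain_def)
    have "subgroup (\<Union>\<C>) G"
    proof (rule subgroupI)
      show "\<Union>\<C> \<subseteq> carrier G" using sub subgroup.subset by (fastforce simp: \<A>_def)
      show "\<Union>\<C> \<noteq> {}" using C(1) sub subgroup.one_closed by (fastforce simp: \<A>_def)
      show "inv a \<in> \<Union>\<C>" if "a \<in> \<Union>\<C>" for a
        using that sub subgroup.m_inv_closed by (fastforce simp: \<A>_def)
      show "a \<otimes> b \<in> \<Union>\<C>" if ab: "a \<in> \<Union>\<C>" "b \<in> \<Union>\<C>" for a b
      proof -
        obtain X Y where "X \<in> \<C>" "Y \<in> \<C>" "a \<in> X" "b \<in> Y" using ab by blast
        then obtain Z where Z: "Z \<in> \<C>" "a \<in> Z" "b \<in> Z" using lin by blast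
        then have "subgroup Z G" using sub by (auto simp: \<A>_def)
        then have "a \<otimes> b \<in> Z" using subgroup.m_closed Z(2,3) by metis
        then show ?thesis using Z(1) by blast
      qed
    qed
    moreover have "F \<subseteq> \<Union>\<C>" using C(1) sub by (fastforce simp: \<A>_def)
    moreover have "x \<notin> \<Union>\<C>" using sub by (auto simp: \<A>_def)
    ultimately show "\<Union>\<C> \<in> \<A>" by (simp add: \<A>_def)
  qed
  then obtain M where M: "M \<in> \<A>" "\<forall>X\<in>\<A>. M \<subseteq> X \<longrightarrow> X = M" by blast
  show ?thesis
  proof (rule that[of M])
    fix N assume "subgroup N G" "M \<subset> N"
    then show "x \<in> N" using M by (auto simp: \<A>_def)
  qed (use M(1) in \<open>auto simp: \<A>_def\<close>)
qed

text \<open>By maximality, \<open>x\<close> lies in every subgroup that properly contains \<open>M\<close>, so the image of \<open>x\<close> lies in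
  every nontrivial subgroup of the quotient by \<open>M\<close>.\<close>
lemma cyclic_chain_modulo_maximal_avoiding:
  assumes "subgroup M G" "x \<in> carrier G" "x \<notin> M"
    and max: "\<And>N. \<lbrakk>subgroup N G; M \<subset> N\<rbrakk> \<Longrightarrow> x \<in> N"
    and yz: "y \<in> carrier G" "z \<in> carrier G"
  shows "(\<exists>k::int. z \<otimes> inv (y [^] k) \<in> M) \<or> (\<exists>k::int. y \<otimes> inv (z [^] k) \<in> M)"
proof -
  interpret M: normal M G using assms(1) by (rule subgroup_imp_normal)
  interpret Q: comm_group "G Mod M" using assms(1) by (rule abelian_FactGroup)
  have eq: "M #> u = M #> v \<longleftrightarrow> u \<otimes> inv v \<in> M" if "u \<in> carrier G" "v \<in> carrier G" for u v
    by (metis M.rcos_module repr_independence rcos_self M.subgroup_axioms that is_group)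
  have pow: "(M #> u) [^]\<^bsub>G Mod M\<^esub> k = M #> (u [^] k)" if "u \<in> carrier G" for u and k :: int
    using M.FactGroup_int_pow[OF that, of k] by simp
  have one: "M #> u = \<one>\<^bsub>G Mod M\<^esub> \<longleftrightarrow> u \<in> M" if "u \<in> carrier G" for u
    using coset_join1[of M u] coset_join2[of u M] that assms(1) M.subset by auto
  have car: "M #> u \<in> carrier (G Mod M)" if "u \<in> carrier G" for u
    using that by (simp add: carrier_FactGroup)
  have "(\<exists>k::int. M #> z = (M #> y) [^]\<^bsub>G Mod M\<^esub> k) \<or> (\<exists>k::int. M #> y = (M #> z) [^]\<^bsub>G Mod M\<^esub> k)"
  proof (rule Q.cyclic_subgroups_chain_if_monolithic[of "M #> x"])
    fix Y assume "Y \<in> carrier (G Mod M)" "Y \<noteq> \<one>\<^bsub>G Mod M\<^esub>"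
    then obtain u where u: "u \<in> carrier G" "Y = M #> u" "u \<notin> M"
      using one by (auto simp: carrier_FactGroup)
    have "M \<subseteq> generate G (insert u M)" "u \<in> generate G (insert u M)"
      by (auto intro: generate.incl)
    then have "x \<in> generate G (insert u M)"
      using u M.subset by (intro max generate_is_subgroup) auto
    then obtain h and k :: int where h: "x = h \<otimes> u [^] k" "h \<in> M"
      using generate_insert_eq[OF assms(1) u(1)] by blast
    then have "x \<otimes> inv (u [^] k) \<in> M" using u(1) M.subset by (simp add: m_assoc subset_iff)
    then have "M #> x = Y [^]\<^bsub>G Mod M\<^esub> k" using eq pow u assms(2) by simp
    then show "\<exists>k::int. M #> x = Y [^]\<^bsub>G Mod M\<^esub> k" by blast
  qed (use assms(2,3) one car yz in auto)
  then show ?thesis using yz by (simp add: pow eq)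
qed

text \<open>The witness is \<open>H' = M \<inter> H\<close> for a subgroup \<open>M\<close> of the whole group that is maximal among those
  containing \<open>F\<close> but not \<open>x\<close>. Modulo \<open>M\<close>, any finitely many elements of \<open>H\<close> are powers of one of
  them, say \<open>w\<close>. Among \<open>e + 1\<close> elements, two have exponents that are congruent modulo \<open>e\<close>, and their
  images under \<open>\<psi>\<close> are congruent modulo \<open>\<psi>(H')\<close>, because \<open>\<psi>\<close> maps \<open>e\<close>-th powers to \<open>\<one>\<close>.\<close>
lemma covered_by_cosets_of_avoiding_subgroup:
  assumes "group K" "\<psi> \<in> hom G K" "0 < e" "\<And>a. a \<in> carrier G \<Longrightarrow> \<psi> a [^]\<^bsub>K\<^esub> (e::nat) = \<one>\<^bsub>K\<^esub>"
    and "subgroup F G" "subgroup H G" "F \<subseteq> H" "x \<in> carrier G" "x \<notin> F"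
  obtains H' where "subgroup H' G" "F \<subseteq> H'" "H' \<subseteq> H" "x \<notin> H'"
    "covered_by_cosets K e (\<psi> ` H) (\<psi> ` H')"
proof -
  interpret \<psi>: group_hom G K \<psi>
    using assms by (simp add: group_hom_def group_hom_axioms_def is_group)
  interpret H: subgroup H G by fact
  obtain M where M: "subgroup M G" "F \<subseteq> M" "x \<notin> M" "\<And>N. \<lbrakk>subgroup N G; M \<subset> N\<rbrakk> \<Longrightarrow> x \<in> N"
    using exists_maximal_subgroup_avoiding[OF assms(5,9)] by blast
  interpret M: subgroup M G by fact
  \<comment> \<open>Modulo \<open>M\<close>, the cyclic subgroups generated by the elements of \<open>U\<close> form a chain, and \<open>w\<close>
    generates the largest of them.\<close>
  have dominating: "\<exists>w\<in>U. \<forall>u\<in>U. \<exists>k::int. u \<otimes> inv (w [^] k) \<in> M"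
    if "finite U" "U \<noteq> {}" "U \<subseteq> carrier G" for U
    using that
  proof (induction U rule: finite_ne_induct)
    case (singleton w)
    then have "w \<otimes> inv (w [^] (1::int)) \<in> M" by simp
    then show ?case by blast
  next
    case (insert v U)
    then obtain w where w: "w \<in> U" "\<forall>u\<in>U. \<exists>k::int. u \<otimes> inv (w [^] k) \<in> M" by auto
    have wv: "w \<in> carrier G" "v \<in> carrier G" using w insert by auto
    from cyclic_chain_modulo_maximal_avoiding[OF M(1) assms(8) M(3,4) wv]
    show ?case
    proof
      assume "\<exists>k::int. v \<otimes> inv (w [^] k) \<in> M"
      then show ?thesis using w by auto
    next
      assume "\<exists>k::int. w \<otimes> inv (v [^] k) \<in> M"
      then obtain k :: int where k: "w \<otimes> inv (v [^] k) \<in> M" by blast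
      have "\<exists>j::int. u \<otimes> inv (v [^] j) \<in> M" if u: "u \<in> insert v U" for u
      proof (cases "u = v")
        case True
        then have "u \<otimes> inv (v [^] (1::int)) \<in> M" using wv by simp
        then show ?thesis by blast
      next
        case False
        then have "u \<in> U" using u by blast
        then obtain i :: int where i: "u \<otimes> inv (w [^] i) \<in> M" using w by blast
        have uc: "u \<in> carrier G" using \<open>u \<in> U\<close> insert by auto
        have "(w \<otimes> inv (v [^] k)) [^] i \<in> M" using subgroup_int_pow_closed[OF M(1) k] .
        also have "(w \<otimes> inv (v [^] k)) [^] i = w [^] i \<otimes> inv (v [^] (k * i))"
          using wv by (simp add: int_pow_distrib int_pow_inv int_pow_pow)
        finally have "(u \<otimes> inv (w [^] i)) \<otimes> (w [^] i \<otimes> inv (v [^] (k * i))) \<in> M"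
          using i by blast
        also have "(u \<otimes> inv (w [^] i)) \<otimes> (w [^] i \<otimes> inv (v [^] (k * i))) = u \<otimes> inv (v [^] (k * i))"
          using uc wv by (metis int_pow_closed inv_closed inv_solve_left m_assoc m_closed)
        finally show ?thesis by blast
      qed
      then show ?thesis by blast
    qed
  qed
  have cov: "covered_by_cosets K e (\<psi> ` H) (\<psi> ` (M \<inter> H))"
  proof (rule group.covered_by_cosets_if_no_incongruent_set[OF assms(1)])
    show "subgroup (\<psi> ` (M \<inter> H)) K"
      using \<psi>.subgroup_img_is_subgroup M(1) assms(6) subgroups_Inter_pair by blast
    show "\<psi> ` H \<subseteq> carrier K" using H.subset by auto
    fix T assume T: "T \<subseteq> \<psi> ` H" "finite T" "card T = Suc e"
    obtain U where U: "U \<subseteq> H" "inj_on \<psi> U" "T = \<psi> ` U" using T(1) subset_image_inj by metis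
    have finU: "finite U" using T(2) U(2,3) finite_imageD by blast
    have cardU: "card U = Suc e" using T(3) U(2,3) card_image by metis
    have Uc: "U \<subseteq> carrier G" using U(1) H.subset by blast
    obtain w where w: "w \<in> U" "\<forall>u\<in>U. \<exists>k::int. u \<otimes> inv (w [^] k) \<in> M"
      using dominating[OF finU _ Uc] cardU by fastforce
    obtain k :: "'a \<Rightarrow> int" where k: "\<forall>u\<in>U. u \<otimes> inv (w [^] k u) \<in> M" using w(2) by metis
    have "\<not> inj_on (\<lambda>u. nat (k u mod int e)) U"
    proof
      assume "inj_on (\<lambda>u. nat (k u mod int e)) U"
      moreover have "(\<lambda>u. nat (k u mod int e)) ` U \<subseteq> {..<e}"
        using assms(3) by (auto simp: nat_less_iff)
      ultimately have "card U \<le> card {..<e}" by (metis card_inj_on_le finite_lessThan)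
      then show False using cardU by simp
    qed
    then obtain u v where uv: "u \<in> U" "v \<in> U" "u \<noteq> v" "nat (k u mod int e) = nat (k v mod int e)"
      by (auto simp: inj_on_def)
    then have "k u mod int e = k v mod int e"
      using assms(3) by (metis int_nat_eq mod_int_pos_iff of_nat_0_less_iff pos_mod_sign)
    then obtain q where q: "k u - k v = int e * q" by (metis mod_eq_dvd_iff dvd_def)
    have c: "u \<in> carrier G" "v \<in> carrier G" "w \<in> carrier G" using uv w Uc by auto
    define m where "m = (u \<otimes> inv (w [^] k u)) \<otimes> inv (v \<otimes> inv (w [^] k v))"
    have "m \<in> M" using k uv by (simp add: m_def)
    moreover have "m \<in> H"
      unfolding m_def using uv w U(1) subgroup_int_pow_closed[OF assms(6), of w]
      by (meson H.m_closed H.m_inv_closed subsetD)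
    moreover have "\<psi> m = \<psi> u \<otimes>\<^bsub>K\<^esub> inv\<^bsub>K\<^esub> \<psi> v"
    proof -
      have "m = (u \<otimes> inv v) \<otimes> inv (w [^] (k u - k v))"
        using c unfolding m_def by (simp add: int_pow_diff inv_mult m_ac)
      then have "\<psi> m = (\<psi> u \<otimes>\<^bsub>K\<^esub> inv\<^bsub>K\<^esub> \<psi> v) \<otimes>\<^bsub>K\<^esub> inv\<^bsub>K\<^esub> (\<psi> w [^]\<^bsub>K\<^esub> (k u - k v))"
        using c by (simp add: \<psi>.hom_int_pow)
      also have "\<psi> w [^]\<^bsub>K\<^esub> (k u - k v) = (\<psi> w [^]\<^bsub>K\<^esub> int e) [^]\<^bsub>K\<^esub> q"
        using c q by (simp add: \<psi>.H.int_pow_pow)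
      also have "\<dots> = \<one>\<^bsub>K\<^esub>" using assms(4)[OF c(3)] by (simp add: int_pow_int)
      finally show ?thesis using c by simp
    qed
    ultimately have "\<psi> u \<otimes>\<^bsub>K\<^esub> inv\<^bsub>K\<^esub> \<psi> v \<in> \<psi> ` (M \<inter> H)" by (metis IntI imageI)
    moreover have "\<psi> u \<noteq> \<psi> v" using uv U(2) by (meson inj_onD)
    ultimately show "\<exists>s\<in>T. \<exists>t\<in>T. s \<noteq> t \<and> s \<otimes>\<^bsub>K\<^esub> inv\<^bsub>K\<^esub> t \<in> \<psi> ` (M \<inter> H)"
      using uv U(3) by blast
  qed
  show ?thesis
    using M(2,3) assms(7) cov subgroups_Inter_pair[OF M(1) assms(6)] by (intro that[of "M \<inter> H"]) auto
qed

text \<open>The elements of \<open>X\<close> are avoided one after the other, at the cost of a factor \<open>e\<close> each.\<close>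
lemma covered_by_cosets_of_subgroup_avoiding_finite_set:
  assumes "group K" "\<psi> \<in> hom G K" "0 < e" "\<And>a. a \<in> carrier G \<Longrightarrow> \<psi> a [^]\<^bsub>K\<^esub> (e::nat) = \<one>\<^bsub>K\<^esub>"
    and "subgroup F G" "subgroup H G" "F \<subseteq> H"
    and "finite X" "X \<subseteq> carrier G" "X \<inter> F = {}"
  shows "\<exists>H'. subgroup H' G \<and> F \<subseteq> H' \<and> H' \<subseteq> H \<and> X \<inter> H' = {} \<and>
    covered_by_cosets K (e ^ card X) (\<psi> ` H) (\<psi> ` H')"
  using assms(8-)
proof (induction X rule: finite_induct)
  case empty
  interpret \<psi>: group_hom G K \<psi>
    using assms by (simp add: group_hom_def group_hom_axioms_def is_group)
  have "\<one>\<^bsub>K\<^esub> \<in> \<psi> ` H" using assms(6) by (metis \<psi>.hom_one imageI subgroup.one_closed)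
  moreover have "\<psi> y \<in> carrier K" if "y \<in> H" for y using that assms(6) by (simp add: subgroup.mem_carrier)
  ultimately have "covered_by_cosets K 1 (\<psi> ` H) (\<psi> ` H)"
    unfolding covered_by_cosets_def by (intro exI[of _ "{\<one>\<^bsub>K\<^esub>}"]) auto
  then show ?case using assms(6,7) by auto
next
  case (insert x X)
  then obtain H1 where H1: "subgroup H1 G" "F \<subseteq> H1" "H1 \<subseteq> H" "X \<inter> H1 = {}"
    "covered_by_cosets K (e ^ card X) (\<psi> ` H) (\<psi> ` H1)" by blast
  have "x \<in> carrier G" "x \<notin> F" using insert.prems by auto
  from covered_by_cosets_of_avoiding_subgroup[OF assms(1-5) H1(1,2) this]
  obtain H2 where H2: "subgroup H2 G" "F \<subseteq> H2" "H2 \<subseteq> H1" "x \<notin> H2"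
    "covered_by_cosets K e (\<psi> ` H1) (\<psi> ` H2)" by blast
  have "\<psi> ` H \<subseteq> carrier K" using assms(2,6) by (auto simp: hom_def subgroup.mem_carrier)
  then have "covered_by_cosets K (e * e ^ card X) (\<psi> ` H) (\<psi> ` H2)"
    using group.covered_by_cosets_trans[OF assms(1) H1(5) H2(5)] by blast
  then show ?case using H1 H2 insert.hyps by (intro exI[of _ H2]) auto
qed

section \<open>Endomorphisms of finite exponent that almost preserve every subgroup\<close>

text \<open>If \<open>n\<close> cosets sufficed for all subgroups above \<open>\<langle>F, a\<rangle>\<close>, then they would do for \<open>\<langle>H, a\<rangle>\<close>
  whenever \<open>H \<ge> F\<close>. Since \<open>\<psi>(H)\<close> has exponent \<open>e\<close>, its intersection with \<open>\<langle>H, a\<rangle>\<close> lies in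
  \<open>e\<close> cosets of \<open>H\<close>, and \<open>\<psi>(H)\<close> would be covered by \<open>e n\<close> cosets of \<open>H\<close>.\<close>
lemma uncovered_above_generate_insert:
  assumes "\<psi> \<in> hom G G" "0 < e" "\<And>a. a \<in> carrier G \<Longrightarrow> \<psi> a [^] (e::nat) = \<one>"
    and "a \<in> carrier G"
    and unb: "\<forall>n. \<exists>H. subgroup H G \<and> F \<subseteq> H \<and> \<not> covered_by_cosets G n (\<psi> ` H) H"
  shows "\<exists>H. subgroup H G \<and> generate G (insert a F) \<subseteq> H \<and> \<not> covered_by_cosets G n (\<psi> ` H) H"
proof (rule ccontr)
  interpret \<psi>: group_hom G G \<psi>
    using assms(1) by (simp add: group_hom_def group_hom_axioms_def is_group)
  assume neg: "\<not> ?thesis"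
  obtain H where H: "subgroup H G" "F \<subseteq> H" "\<not> covered_by_cosets G (e * n) (\<psi> ` H) H"
    using unb by blast
  interpret H: subgroup H G by fact
  let ?Ha = "generate G (insert a H)"
  have Ha: "subgroup ?Ha G" using assms(4) H.subset by (intro generate_is_subgroup) auto
  have "H \<subseteq> ?Ha" by (auto intro: generate.incl)
  have "insert a F \<subseteq> insert a H" using H(2) by blast
  then have "generate G (insert a F) \<subseteq> ?Ha" by (rule mono_generate)
  then have "covered_by_cosets G n (\<psi> ` ?Ha) ?Ha" using neg Ha by blast
  then have "covered_by_cosets G n (id ` \<psi> ` H) ?Ha"
    using \<open>H \<subseteq> ?Ha\<close> by (auto intro: covered_by_cosets_mono)
  moreover have imH: "subgroup (\<psi> ` H) G" using \<psi>.subgroup_img_is_subgroup H(1) by blast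
  moreover have "id \<in> hom G G" by (simp add: hom_def)
  ultimately have 1: "covered_by_cosets G n (\<psi> ` H) {y \<in> \<psi> ` H. id y \<in> ?Ha}"
    using covered_by_cosets_preimage[OF _ is_group _ Ha] by blast
  have "y [^] e \<in> H" if "y \<in> {y \<in> \<psi> ` H. id y \<in> ?Ha}" for y using that assms(3) by auto
  then have 2: "covered_by_cosets G e {y \<in> \<psi> ` H. id y \<in> ?Ha} H"
    by (intro covered_bounded_exponent_cyclic_extension[OF H(1) assms(4,2)]) auto
  have "covered_by_cosets G (e * n) (\<psi> ` H) H"
    using covered_by_cosets_trans[OF 1 2] imH subgroup.subset by blast
  then show False using H(3) by blast
qed

text \<open>If there is no such \<open>h\<close>, then any \<open>h\<close> for which \<open>\<langle>F, h\<rangle>\<close> avoids the differences \<open>X\<close> of elements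
  of \<open>Y\<close> has \<open>\<psi>(h)\<close> congruent to an element of \<open>Y\<close> modulo \<open>\<langle>F, h\<rangle>\<close>. This applies to all elements
  of a subgroup \<open>H'\<close> between \<open>F\<close> and \<open>H\<close> that avoids \<open>X\<close>, so that \<open>\<psi>(H')\<close> lies in \<open>|Y|\<close> cosets of
  \<open>H\<close>. With \<open>|\<psi>(H) : \<psi>(H')| \<le> e\<^bsup>|X|\<^esup>\<close>, this bounds the number of cosets of \<open>H\<close> that meet
  \<open>\<psi>(H)\<close>, for all \<open>H\<close> at once.\<close>
lemma exists_new_incongruent_image:
  assumes "\<psi> \<in> hom G G" "0 < e" "\<And>a. a \<in> carrier G \<Longrightarrow> \<psi> a [^] (e::nat) = \<one>"
    and "subgroup F G" "finite Y" "Y \<subseteq> carrier G"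
    and Y: "\<And>y z. \<lbrakk>y \<in> Y; z \<in> Y; y \<noteq> z\<rbrakk> \<Longrightarrow> y \<otimes> inv z \<notin> F"
    and unb: "\<forall>n. \<exists>H. subgroup H G \<and> F \<subseteq> H \<and> \<not> covered_by_cosets G n (\<psi> ` H) H"
  shows "\<exists>h \<in> carrier G.
    (\<forall>y\<in>Y. \<forall>z\<in>Y. y \<noteq> z \<longrightarrow> y \<otimes> inv z \<notin> generate G (insert h F)) \<and>
    (\<forall>y\<in>Y. \<psi> h \<otimes> inv y \<notin> generate G (insert h F))"
proof (rule ccontr)
  assume neg: "\<not> ?thesis"
  define X where "X = (\<lambda>(y, z). y \<otimes> inv z) ` {(y, z) \<in> Y \<times> Y. y \<noteq> z}"
  have X: "finite X" "X \<subseteq> carrier G" "X \<inter> F = {}"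
  proof -
    have "finite {(y, z) \<in> Y \<times> Y. y \<noteq> z}"
      using assms(5) by (auto intro: finite_subset[of _ "Y \<times> Y"])
    then show "finite X" by (simp add: X_def)
    show "X \<subseteq> carrier G" using assms(6) by (auto simp: X_def)
    show "X \<inter> F = {}" using Y by (auto simp: X_def)
  qed
  obtain H where H: "subgroup H G" "F \<subseteq> H"
    "\<not> covered_by_cosets G (card Y * e ^ card X) (\<psi> ` H) H"
    using unb by blast
  obtain H' where H': "subgroup H' G" "F \<subseteq> H'" "H' \<subseteq> H" "X \<inter> H' = {}"
    "covered_by_cosets G (e ^ card X) (\<psi> ` H) (\<psi> ` H')"
    using covered_by_cosets_of_subgroup_avoiding_finite_set[OF is_group assms(1,2,3,4) H(1,2) X]
    by blast
  have "\<exists>y\<in>Y. \<psi> h \<otimes> inv y \<in> H" if h: "h \<in> H'" for h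
  proof -
    have hc: "h \<in> carrier G" using h H'(1) subgroup.mem_carrier by metis
    have sub: "generate G (insert h F) \<subseteq> H'"
      using H'(1,2) h by (intro generate_subgroup_incl) auto
    have "\<forall>y\<in>Y. \<forall>z\<in>Y. y \<noteq> z \<longrightarrow> y \<otimes> inv z \<notin> generate G (insert h F)"
    proof (intro ballI impI)
      fix y z assume "y \<in> Y" "z \<in> Y" "y \<noteq> z"
      then have "y \<otimes> inv z \<in> X" by (auto simp: X_def)
      then show "y \<otimes> inv z \<notin> generate G (insert h F)" using H'(4) sub by blast
    qed
    then obtain y where "y \<in> Y" "\<psi> h \<otimes> inv y \<in> generate G (insert h F)"
      using neg hc by blast
    then show ?thesis using sub H'(3) by blast
  qed
  then have "covered_by_cosets G (card Y) (\<psi> ` H') H"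
    unfolding covered_by_cosets_def using assms(5,6) by (intro exI[of _ Y]) auto
  moreover have "\<psi> ` H \<subseteq> carrier G"
    using assms(1) H(1) by (auto simp: hom_def subgroup.mem_carrier)
  ultimately have "covered_by_cosets G (card Y * e ^ card X) (\<psi> ` H) H"
    using covered_by_cosets_trans[OF H'(5)] by blast
  then show False using H(3) by blast
qed

text \<open>If there is no uniform bound, subgroups \<open>F\<^sub>0 \<le> F\<^sub>1 \<le> \<dots>\<close> and finite sets
  \<open>Y\<^sub>0 \<subset> Y\<^sub>1 \<subset> \<dots>\<close> with \<open>Y\<^sub>i \<subseteq> \<psi>(F\<^sub>i)\<close> are chosen such that the elements of \<open>Y\<^sub>i\<close> are pairwise
  incongruent modulo \<open>F\<^sub>i\<close>. The elements of \<open>\<Union>Y\<^sub>i\<close> are then pairwise incongruent modulo the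
  subgroup \<open>\<Union>F\<^sub>i\<close>, whose image under \<open>\<psi>\<close> therefore meets infinitely many of its cosets.\<close>
lemma bounded_covering_if_finite_covering:
  assumes \<psi>: "\<psi> \<in> hom G G" "0 < e" "\<And>a. a \<in> carrier G \<Longrightarrow> \<psi> a [^] (e::nat) = \<one>"
    and fin: "\<And>H. subgroup H G \<Longrightarrow> \<exists>n. covered_by_cosets G n (\<psi> ` H) H"
  shows "\<exists>n. \<forall>H. subgroup H G \<longrightarrow> covered_by_cosets G n (\<psi> ` H) H"
proof (rule ccontr)
  interpret \<psi>: group_hom G G \<psi>
    using \<psi>(1) by (simp add: group_hom_def group_hom_axioms_def is_group)
  assume neg: "\<not> ?thesis"
  define unb where
    "unb = (\<lambda>F. \<forall>n. \<exists>H. subgroup H G \<and> F \<subseteq> H \<and> \<not> covered_by_cosets G n (\<psi> ` H) H)"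
  define state where "state = (\<lambda>(F, Y). subgroup F G \<and> unb F \<and> finite Y \<and> Y \<subseteq> \<psi> ` F \<and>
    (\<forall>y\<in>Y. \<forall>z\<in>Y. y \<noteq> z \<longrightarrow> y \<otimes> inv z \<notin> F))"
  \<comment> \<open>The second components have to grow strictly, so that \<open>Y k\<close> has at least \<open>k\<close> elements.\<close>
  define extends where "extends = (\<lambda>(F :: 'a set, Y :: 'a set) (F', Y'). F \<subseteq> F' \<and> Y \<subset> Y')"
  have "unb {\<one>}" unfolding unb_def
  proof
    fix n
    obtain H where "subgroup H G" "\<not> covered_by_cosets G n (\<psi> ` H) H" using neg by blast
    then show "\<exists>H. subgroup H G \<and> {\<one>} \<subseteq> H \<and> \<not> covered_by_cosets G n (\<psi> ` H) H"
      using subgroup.one_closed by blast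
  qed
  then have start: "state ({\<one>}, {})" by (simp add: state_def triv_subgroup)
  have step: "\<exists>s'. state s' \<and> extends s s'" if s: "state s" for s
  proof -
    obtain F Y where FY: "s = (F, Y)" by (cases s)
    have F: "subgroup F G" "unb F" and Y: "finite Y" "Y \<subseteq> \<psi> ` F"
      and inc: "\<And>y z. \<lbrakk>y \<in> Y; z \<in> Y; y \<noteq> z\<rbrakk> \<Longrightarrow> y \<otimes> inv z \<notin> F"
      using s unfolding FY state_def by auto
    have Fc: "F \<subseteq> carrier G" using F(1) subgroup.subset by blast
    then have Yc: "Y \<subseteq> carrier G" using Y(2) \<psi>.hom_closed by blast
    obtain h where h: "h \<in> carrier G"
      "\<forall>y\<in>Y. \<forall>z\<in>Y. y \<noteq> z \<longrightarrow> y \<otimes> inv z \<notin> generate G (insert h F)"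
      "\<forall>y\<in>Y. \<psi> h \<otimes> inv y \<notin> generate G (insert h F)"
      using exists_new_incongruent_image[OF \<psi> F(1) Y(1) Yc inc F(2)[unfolded unb_def]] by blast
    let ?F = "generate G (insert h F)"
    have sub: "F \<subseteq> ?F" "h \<in> ?F" by (auto intro: generate.incl)
    have subg: "subgroup ?F G" using h(1) Fc by (intro generate_is_subgroup) auto
    have "inv (y \<otimes> inv (\<psi> h)) = \<psi> h \<otimes> inv y" if "y \<in> Y" for y
      using that Yc h(1) by (simp add: inv_mult_group subset_iff)
    then have h': "y \<otimes> inv (\<psi> h) \<notin> ?F" if "y \<in> Y" for y
      using that h(3) subgroup.m_inv_closed[OF subg] by metis
    have "\<psi> h \<notin> Y"
      using h(3) subgroup.one_closed[OF subg] h(1) \<psi>.hom_closed by (metis r_inv)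
    moreover have "unb ?F" unfolding unb_def
      using uncovered_above_generate_insert[OF \<psi> h(1) F(2)[unfolded unb_def]] by blast
    ultimately have "state (?F, insert (\<psi> h) Y)" "extends s (?F, insert (\<psi> h) Y)"
      using subg Y sub h(2,3) h' by (auto simp: state_def extends_def FY)
    then show ?thesis by blast
  qed
  obtain f where f: "\<And>n. state (f n)" "\<And>n. extends (f n) (f (Suc n))"
    using dependent_nat_choice[of "\<lambda>_. state" "\<lambda>_. extends"] start step by metis
  define F where "F = fst \<circ> f"
  define Y where "Y = snd \<circ> f"
  have FY: "f n = (F n, Y n)" for n by (simp add: F_def Y_def)
  have F: "subgroup (F n) G" "F n \<subseteq> F (Suc n)" for n
    using f[of n] by (auto simp: FY state_def extends_def)
  have Y: "finite (Y n)" "Y n \<subseteq> \<psi> ` F n" "Y n \<subset> Y (Suc n)" for n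
    using f[of n] by (auto simp: FY state_def extends_def)
  have inc: "y \<otimes> inv z \<notin> F n" if "y \<in> Y n" "z \<in> Y n" "y \<noteq> z" for y z n
    using f(1)[of n] that by (auto simp: FY state_def)
  have monoF: "F m \<subseteq> F n" if "m \<le> n" for m n using lift_Suc_mono_le[of F] F(2) that by blast
  have monoY: "Y m \<subseteq> Y n" if "m \<le> n" for m n using lift_Suc_mono_le[of Y] Y(3) that by blast
  let ?H = "\<Union>n. F n"
  have H: "subgroup ?H G"
  proof (rule subgroupI)
    show "?H \<subseteq> carrier G" using F(1) subgroup.subset by blast
    show "?H \<noteq> {}" using F(1) subgroup.one_closed by blast
    show "inv a \<in> ?H" if a: "a \<in> ?H" for a
    proof -
      obtain n where "a \<in> F n" using a by blast
      then have "inv a \<in> F n" by (rule subgroup.m_inv_closed[OF F(1)])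
      then show ?thesis by blast
    qed
    show "a \<otimes> b \<in> ?H" if ab: "a \<in> ?H" "b \<in> ?H" for a b
    proof -
      obtain m n where mn: "a \<in> F m" "b \<in> F n" using ab by blast
      have "a \<in> F (max m n)" "b \<in> F (max m n)"
        using mn monoF[of m "max m n"] monoF[of n "max m n"] by auto
      then have "a \<otimes> b \<in> F (max m n)" by (rule subgroup.m_closed[OF F(1)])
      then show ?thesis by blast
    qed
  qed
  obtain n where n: "covered_by_cosets G n (\<psi> ` ?H) ?H" using fin[OF H] by blast
  have Hc: "\<psi> ` ?H \<subseteq> carrier G" using H subgroup.subset \<psi>.hom_closed by blast
  have "y \<otimes> inv z \<notin> ?H" if yz: "y \<in> Y (Suc n)" "z \<in> Y (Suc n)" "y \<noteq> z" for y z
  proof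
    assume "y \<otimes> inv z \<in> ?H"
    then obtain k where k: "y \<otimes> inv z \<in> F k" by blast
    let ?m = "max k (Suc n)"
    have "y \<in> Y ?m" "z \<in> Y ?m" "y \<otimes> inv z \<in> F ?m"
      using yz k monoY[of "Suc n" ?m] monoF[of k ?m] by auto
    then show False using inc yz(3) by blast
  qed
  moreover have "Y (Suc n) \<subseteq> \<psi> ` ?H" using Y(2)[of "Suc n"] by blast
  ultimately have "card (Y (Suc n)) \<le> n"
    using card_le_if_covered_by_cosets[OF n H Hc, of "Y (Suc n)"] by blast
  moreover have "k \<le> card (Y k)" for k
  proof (induction k)
    case (Suc k)
    then show ?case using psubset_card_mono[OF Y(1) Y(3)[of k]] by linarith
  qed simp
  ultimately show False by (metis not_less_eq_eq)
qed

text \<open>The conditions are imposed one at a time; each of them multiplies the index by at most its own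
  bound.\<close>
lemma bounded_simultaneous_invariance:
  assumes "finite T" "\<And>t. t \<in> T \<Longrightarrow> \<psi> t \<in> hom G G"
    and "\<And>t. t \<in> T \<Longrightarrow> \<exists>n. \<forall>H. subgroup H G \<longrightarrow> covered_by_cosets G n (\<psi> t ` H) H"
  shows "\<exists>n. \<forall>H. subgroup H G \<longrightarrow> covered_by_cosets G n H {h \<in> H. \<forall>t\<in>T. \<psi> t h \<in> H}"
  using assms
proof (induction T rule: finite_induct)
  case empty
  have "covered_by_cosets G 1 H H" if H: "subgroup H G" for H
    unfolding covered_by_cosets_def using subgroup.mem_carrier[OF H]
    by (intro exI[of _ "{\<one>}"]) simp
  then show ?case by auto
next
  case (insert t T)
  then obtain n where n: "\<And>H. subgroup H G \<Longrightarrow> covered_by_cosets G n H {h \<in> H. \<forall>t\<in>T. \<psi> t h \<in> H}"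
    by auto
  obtain m where m: "\<And>H. subgroup H G \<Longrightarrow> covered_by_cosets G m (\<psi> t ` H) H"
    using insert.prems(2) by blast
  have "covered_by_cosets G (m * n) H {h \<in> H. \<forall>t\<in>insert t T. \<psi> t h \<in> H}" if H: "subgroup H G" for H
  proof -
    interpret H: subgroup H G by fact
    let ?K = "{h \<in> H. \<forall>t\<in>T. \<psi> t h \<in> H}"
    have hom: "group_hom G G (\<psi> s)" if "s \<in> T" for s
      using insert.prems(1) that by (simp add: group_hom_def group_hom_axioms_def is_group)
    have K: "subgroup ?K G"
    proof (rule subgroupI)
      show "?K \<subseteq> carrier G" by auto
      have "\<one> \<in> ?K" using group_hom.hom_one[OF hom] by simp
      then show "?K \<noteq> {}" by blast
      show "inv a \<in> ?K" if "a \<in> ?K" for a using that group_hom.hom_inv[OF hom] by simp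
      show "a \<otimes> b \<in> ?K" if "a \<in> ?K" "b \<in> ?K" for a b using that group_hom.hom_mult[OF hom] by simp
    qed
    have "covered_by_cosets G m (\<psi> t ` ?K) H"
      by (rule covered_by_cosets_mono[OF m[OF H]]) auto
    then have "covered_by_cosets G m ?K {h \<in> ?K. \<psi> t h \<in> H}"
      using covered_by_cosets_preimage[OF K is_group _ H] insert.prems(1) by blast
    then have "covered_by_cosets G (m * n) H {h \<in> ?K. \<psi> t h \<in> H}"
      using covered_by_cosets_trans[OF n[OF H] _ H.subset] by blast
    moreover have "{h \<in> ?K. \<psi> t h \<in> H} = {h \<in> H. \<forall>t\<in>insert t T. \<psi> t h \<in> H}" by blast
    ultimately show ?thesis by simp
  qed
  then show ?case by blast
qed

end

section \<open>Conjugation and normal cores\<close>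

context group
begin

lemma conjugate_set_eq: "conjugate_set G X g = (\<lambda>h. inv g \<otimes> h \<otimes> g) ` X"
  unfolding conjugate_set_def l_coset_def r_coset_def by auto

text \<open>Conjugates by \<open>g\<close> are formed with \<open>inv g\<close> on the left, so membership in the conjugate of \<open>H\<close> is
  tested with \<open>g\<close> on the left.\<close>
lemma mem_normal_core_iff:
  assumes "H \<subseteq> carrier G"
  shows "x \<in> normal_core G H \<longleftrightarrow> x \<in> carrier G \<and> (\<forall>g\<in>carrier G. g \<otimes> x \<otimes> inv g \<in> H)"
proof -
  have 1: "x \<in> conjugate_set G H g \<longleftrightarrow> x \<in> carrier G \<and> g \<otimes> x \<otimes> inv g \<in> H" if g: "g \<in> carrier G" for g
  proof
    assume "x \<in> conjugate_set G H g"
    then obtain h where h: "h \<in> H" "x = inv g \<otimes> h \<otimes> g" unfolding conjugate_set_eq by blast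
    then have hc: "h \<in> carrier G" using assms by blast
    then have "g \<otimes> x \<otimes> inv g = h" using g h(2) by (simp add: m_assoc) (simp flip: m_assoc)
    then show "x \<in> carrier G \<and> g \<otimes> x \<otimes> inv g \<in> H" using h hc g by simp
  next
    assume x: "x \<in> carrier G \<and> g \<otimes> x \<otimes> inv g \<in> H"
    then have "inv g \<otimes> (g \<otimes> x \<otimes> inv g) \<otimes> g = x"
      using g by (simp add: m_assoc) (simp flip: m_assoc)
    then show "x \<in> conjugate_set G H g" unfolding conjugate_set_eq using x by force
  qed
  show ?thesis unfolding normal_core_def using 1 one_closed by blast
qed

lemma conj_hom: "g \<in> carrier G \<Longrightarrow> (\<lambda>x. inv g \<otimes> x \<otimes> g) \<in> hom G G"
proof (rule homI)
  fix x y assume "g \<in> carrier G" "x \<in> carrier G" "y \<in> carrier G"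
  then show "inv g \<otimes> (x \<otimes> y) \<otimes> g = (inv g \<otimes> x \<otimes> g) \<otimes> (inv g \<otimes> y \<otimes> g)"
    by (simp add: m_assoc) (simp flip: m_assoc)
qed simp

lemma conj_int_pow:
  assumes "g \<in> carrier G" "x \<in> carrier G"
  shows "inv g \<otimes> (x [^] (k::int)) \<otimes> g = (inv g \<otimes> x \<otimes> g) [^] k"
  using hom_int_pow[OF conj_hom[OF assms(1)] assms(2) is_group is_group, of k] by simp

lemma normal_core_subset: "H \<subseteq> carrier G \<Longrightarrow> normal_core G H \<subseteq> H"
  using mem_normal_core_iff[of H] one_closed
  by (metis inv_one l_one r_one subsetI)

lemma subgroup_normal_core:
  assumes "subgroup H G"
  shows "subgroup (normal_core G H) G"
proof -
  interpret H: subgroup H G by fact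
  note core = mem_normal_core_iff[OF H.subset]
  have eq: "g \<otimes> (x \<otimes> y) \<otimes> inv g = (g \<otimes> x \<otimes> inv g) \<otimes> (g \<otimes> y \<otimes> inv g)"
    "g \<otimes> inv x \<otimes> inv g = inv (g \<otimes> x \<otimes> inv g)"
    if "g \<in> carrier G" "x \<in> carrier G" "y \<in> carrier G" for g x y
    using that by (simp_all add: m_assoc inv_mult_group) (simp flip: m_assoc)
  show ?thesis
  proof (rule subgroupI)
    show "normal_core G H \<subseteq> carrier G" using core by blast
    have "\<one> \<in> normal_core G H" using core by simp
    then show "normal_core G H \<noteq> {}" by blast
    fix x assume x: "x \<in> normal_core G H"
    show "inv x \<in> normal_core G H"
      using x eq(2)[of _ x \<one>] unfolding core by simp
    fix y assume y: "y \<in> normal_core G H"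
    show "x \<otimes> y \<in> normal_core G H" using x y eq(1) unfolding core by simp
  qed
qed

lemma conj_mem_normal_core:
  assumes "subgroup H G" "x \<in> normal_core G H" "g \<in> carrier G"
  shows "inv g \<otimes> x \<otimes> g \<in> normal_core G H"
proof -
  note core = mem_normal_core_iff[OF subgroup.subset[OF assms(1)]]
  have x: "x \<in> carrier G" using assms(2) core by blast
  have "k \<otimes> (inv g \<otimes> x \<otimes> g) \<otimes> inv k \<in> H" if k: "k \<in> carrier G" for k
  proof -
    have "k \<otimes> (inv g \<otimes> x \<otimes> g) \<otimes> inv k = (k \<otimes> inv g) \<otimes> x \<otimes> inv (k \<otimes> inv g)"
      using k assms(3) x by (simp add: m_assoc inv_mult_group)
    then show ?thesis using assms(2,3) k unfolding core by simp
  qed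
  then show ?thesis using core x assms(3) by simp
qed

lemma cosets_in_normal_core_card_iff:
  assumes "subgroup H G"
  shows "finite (cosets_in G H (normal_core G H)) \<and> card (cosets_in G H (normal_core G H)) \<le> n
    \<longleftrightarrow> covered_by_cosets G n H (normal_core G H)"
  using assms normal_core_subset subgroup.subset
  by (intro cosets_in_card_iff subgroup_normal_core) blast+

lemma BCF_group_iff:
  "BCF_group G \<longleftrightarrow> (\<exists>n. \<forall>H. subgroup H G \<longrightarrow> covered_by_cosets G n H (normal_core G H))"
  unfolding BCF_group_def using is_group cosets_in_normal_core_card_iff by blast

lemma CF_group_iff:
  "CF_group G \<longleftrightarrow> (\<forall>H. subgroup H G \<longrightarrow> (\<exists>n. covered_by_cosets G n H (normal_core G H)))"
  unfolding CF_group_def using is_group cosets_in_normal_core_card_iff by blast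

end

section \<open>Power automorphisms\<close>

context group
begin

lemma int_pow_eq_one_iff_zero:
  "\<lbrakk>x \<in> carrier G; ord x = 0\<rbrakk> \<Longrightarrow> x [^] (k::int) = \<one> \<longleftrightarrow> k = 0"
  by (simp add: int_pow_eq_id)

text \<open>An element \<open>v\<close> of infinite order generates the same subgroup as \<open>\<theta>(v)\<close>, so \<open>\<theta>(v) = v\<^sup>\<plusminus>\<^sup>1\<close>. Were the
  signs different for \<open>u\<close> and \<open>v\<close>, then comparing \<open>\<theta>(u v) = (u v)\<^sup>m\<close> with \<open>\<theta>(u) \<theta>(v)\<close> would
  give a common power \<open>w = u\<^bsup>\<epsilon> - m\<^esup> = v\<^bsup>m + \<epsilon>\<^esup>\<close> on which \<open>\<theta>\<close> acts with both signs; so \<open>w\<^sup>2 = \<one>\<close>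
  and both exponents vanish, which contradicts \<open>\<epsilon> \<noteq> 0\<close>. If \<open>v\<close> has finite order, then \<open>u v\<close>
  has infinite order and carries the same sign as \<open>u\<close>.\<close>
lemma power_automorphism_sign:
  assumes \<theta>: "\<theta> \<in> hom G G" and V: "subgroup V G"
    and comm: "\<And>v w. \<lbrakk>v \<in> V; w \<in> V\<rbrakk> \<Longrightarrow> v \<otimes> w = w \<otimes> v"
    and pow: "\<And>v. v \<in> V \<Longrightarrow> \<exists>i::int. \<theta> v = v [^] i"
    and inv: "\<And>v. v \<in> V \<Longrightarrow> \<exists>i::int. v = (\<theta> v) [^] i"
    and u: "u \<in> V" "ord u = 0"
  shows "\<exists>\<epsilon>\<in>{1, -1::int}. \<forall>v\<in>V. \<theta> v = v [^] \<epsilon>"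
proof -
  interpret V: subgroup V G by fact
  interpret \<theta>: group_hom G G \<theta>
    using \<theta> by (simp add: group_hom_def group_hom_axioms_def is_group)
  have sign: "\<exists>\<epsilon>\<in>{1, -1::int}. \<theta> v = v [^] \<epsilon>" if v: "v \<in> V" "ord v = 0" for v
  proof -
    \<comment> \<open>The two exponents are inverse to each other in the ring of integers.\<close>
    obtain i j :: int where ij: "\<theta> v = v [^] i" "v = \<theta> v [^] j" using pow inv v(1) by metis
    then have "v [^] (1::int) = v [^] (i * j)" using v(1) by (simp add: int_pow_pow)
    then have "i * j - 1 = 0" using int_pow_eq[of v 1 "i * j"] v by simp
    then have "i = 1 \<or> i = -1" by (auto simp: zmult_eq_1_iff)
    then show ?thesis using ij(1) by blast
  qed
  obtain \<epsilon> where \<epsilon>: "\<epsilon> \<in> {1, -1::int}" "\<theta> u = u [^] \<epsilon>" using sign u by blast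
  have inf: "\<theta> v = v [^] \<epsilon>" if v: "v \<in> V" "ord v = 0" for v
  proof (rule ccontr)
    assume neq: "\<theta> v \<noteq> v [^] \<epsilon>"
    then have \<theta>v: "\<theta> v = v [^] (- \<epsilon>)" using sign[OF v] \<epsilon>(1) by auto
    obtain m :: int where m: "\<theta> (u \<otimes> v) = (u \<otimes> v) [^] m" using pow u(1) v(1) by blast
    have "u [^] \<epsilon> \<otimes> v [^] (- \<epsilon>) = u [^] m \<otimes> v [^] m"
      using m \<epsilon>(2) \<theta>v u v int_pow_mult_distrib[OF comm[OF u(1) v(1)]] by simp
    then have "inv (u [^] m) \<otimes> (u [^] \<epsilon> \<otimes> v [^] (- \<epsilon>)) \<otimes> inv (v [^] (- \<epsilon>))
        = inv (u [^] m) \<otimes> (u [^] m \<otimes> v [^] m) \<otimes> inv (v [^] (- \<epsilon>))" by simp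
    then have "inv (u [^] m) \<otimes> u [^] \<epsilon> = v [^] m \<otimes> inv (v [^] (- \<epsilon>))"
      using u(1) v(1) by (simp add: m_assoc) (simp flip: m_assoc)
    then have w: "u [^] (\<epsilon> - m) = v [^] (m + \<epsilon>)"
      using u(1) v(1) by (metis V.mem_carrier add.commute diff_conv_add_uminus int_pow_mult int_pow_neg minus_minus)
    let ?w = "u [^] (\<epsilon> - m)"
    have "\<theta> ?w = ?w [^] \<epsilon>"
      using \<epsilon>(2) u(1) by (simp add: \<theta>.hom_int_pow int_pow_pow mult.commute)
    moreover have "\<theta> ?w = ?w [^] (- \<epsilon>)"
      unfolding w using \<theta>v v(1) by (simp add: \<theta>.hom_int_pow int_pow_pow mult.commute)
    ultimately have "?w [^] \<epsilon> \<otimes> inv (?w [^] (- \<epsilon>)) = \<one>" using u(1) by simp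
    then have "?w [^] (\<epsilon> - - \<epsilon>) = \<one>"
      using int_pow_diff[of ?w \<epsilon> "- \<epsilon>"] u(1) V.mem_carrier int_pow_closed by presburger
    then have w1: "?w [^] (2 * \<epsilon>) = \<one>" by simp
    then have "(\<epsilon> - m) * (2 * \<epsilon>) = 0"
      using u int_pow_eq_one_iff_zero[of u "(\<epsilon> - m) * (2 * \<epsilon>)"] by (simp add: int_pow_pow)
    moreover have "(m + \<epsilon>) * (2 * \<epsilon>) = 0"
      using w1 v int_pow_eq_one_iff_zero[of v "(m + \<epsilon>) * (2 * \<epsilon>)"] unfolding w by (simp add: int_pow_pow)
    ultimately show False using \<epsilon>(1) by auto
  qed
  have "\<theta> v = v [^] \<epsilon>" if v: "v \<in> V" for v
  proof (cases "ord v = 0")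
    case False
    have uv: "(u \<otimes> v) [^] k = u [^] k \<otimes> v [^] k" for k :: int
      using int_pow_mult_distrib[OF comm[OF u(1) v]] u v by simp
    have "ord (u \<otimes> v) = 0"
    proof (rule ccontr)
      assume nz: "ord (u \<otimes> v) \<noteq> 0"
      let ?k = "int (ord (u \<otimes> v)) * int (ord v)"
      have "u [^] ?k \<otimes> v [^] ?k = \<one>"
        using int_pow_eq_id[of "u \<otimes> v" ?k] u v by (simp flip: uv)
      moreover have "v [^] ?k = \<one>" using int_pow_eq_id[of v ?k] v by simp
      ultimately have "u [^] ?k = \<one>" using u v by simp
      then show False using int_pow_eq_one_iff_zero[of u ?k] u nz False by simp
    qed
    then have "\<theta> (u \<otimes> v) = (u \<otimes> v) [^] \<epsilon>" using inf u(1) v by blast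
    then show ?thesis using uv \<epsilon>(2) u(1) v by simp
  qed (use inf v in blast)
  then show ?thesis using \<epsilon>(1) by blast
qed

text \<open>The exponents \<open>k\<close> for which \<open>a\<^sup>k\<close> lies in the core of \<open>\<langle>a\<rangle>\<close> are the multiples of a single \<open>d\<close>,
  and some positive such \<open>k\<close> is at most \<open>n\<close>; so \<open>d\<close> divides \<open>n!\<close>. As the core is normal, the
  conjugate of \<open>a\<^sup>d\<close> is a power of \<open>a\<^sup>d\<close>, and this passes to powers of \<open>a\<^sup>d\<close>. The generator \<open>d\<close> is
  needed because \<open>a\<^sup>r\<close> in the core would only make the conjugate of \<open>a\<^sup>r\<close> a power of \<open>a\<close>.\<close>
lemma conj_factorial_power:
  assumes bound: "\<And>H. subgroup H G \<Longrightarrow> covered_by_cosets G n H (normal_core G H)"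
    and a: "a \<in> carrier G" and g: "g \<in> carrier G"
  shows "\<exists>j::int. inv g \<otimes> a [^] (fact n :: int) \<otimes> g = (a [^] (fact n :: int)) [^] j"
proof -
  let ?H = "generate G {a}"
  have H: "subgroup ?H G" using a by (simp add: generate_is_subgroup)
  have powH: "a [^] k \<in> ?H" for k :: int
    using generate_pow[OF a] by auto
  let ?K = "normal_core G ?H"
  have K: "subgroup ?K G" using subgroup_normal_core[OF H] .
  define D where "D = {k::int. a [^] k \<in> ?K}"
  have D: "k - l * q \<in> D" if "k \<in> D" "l \<in> D" for k l q
  proof -
    have "a [^] (k - l * q) = a [^] k \<otimes> inv ((a [^] l) [^] q)"
      using a by (simp add: int_pow_diff int_pow_pow)
    then show ?thesis
      using that subgroup_int_pow_closed[OF K, of "a [^] l" q] subgroup.m_closed[OF K] subgroup.m_inv_closed[OF K]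
      unfolding D_def by simp
  qed
  obtain r where r: "0 < r" "r \<le> n" "a [^] r \<in> ?K"
    using exists_power_in_if_covered_by_cosets[OF bound[OF H] K a] powH int_pow_int by metis
  then have rD: "int r \<in> D" by (simp add: D_def int_pow_int)
  obtain d where d: "d \<in> D" "\<And>k. k \<in> D \<Longrightarrow> d dvd k" using int_ideal_principal[OF rD D] by blast
  have "int r dvd fact n" using r by (metis dvd_fact of_nat_dvd_iff of_nat_fact One_nat_def Suc_leI)
  then obtain c where c: "fact n = d * c" using d(2)[OF rD] by (meson dvdE dvd_trans)
  have dK: "a [^] d \<in> ?K" using d(1) by (simp add: D_def)
  have "inv g \<otimes> a [^] d \<otimes> g \<in> ?K" using conj_mem_normal_core[OF H dK g] .
  moreover have "?K \<subseteq> ?H" using normal_core_subset subgroup.subset[OF H] by blast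
  ultimately obtain k :: int where k: "inv g \<otimes> a [^] d \<otimes> g = a [^] k" "k \<in> D"
    using generate_pow[OF a] unfolding D_def by auto
  then obtain q where q: "k = d * q" using d(2) by blast
  have "inv g \<otimes> a [^] (d * c) \<otimes> g = (inv g \<otimes> a [^] d \<otimes> g) [^] c"
    using conj_int_pow[OF g, of "a [^] d" c] a by (simp add: int_pow_pow)
  also have "\<dots> = (a [^] (d * c)) [^] q"
    unfolding k(1) q using a by (simp add: int_pow_pow mult_ac)
  finally show ?thesis unfolding c by blast
qed

text \<open>The group \<open>V\<close> of \<open>n!\<close>-th powers of elements of \<open>A\<close> inherits an element of infinite order from
  \<open>A\<close>, and conjugation by \<open>g\<close> and by \<open>inv g\<close> maps each of its elements to a power of itself.\<close>
lemma sign_action_on_power_subgroup: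
  assumes bound: "\<And>H. subgroup H G \<Longrightarrow> covered_by_cosets G n H (normal_core G H)"
    and A: "A \<lhd> G" "comm_group (G\<lparr>carrier := A\<rparr>)"
    and u: "u \<in> A" "ord u = 0" and g: "g \<in> carrier G"
  shows "\<exists>\<epsilon>\<in>{1, -1::int}. \<forall>a\<in>A. (inv g \<otimes> a \<otimes> g) [^] (fact n :: int) = (a [^] (fact n :: int)) [^] \<epsilon>"
proof -
  interpret A: normal A G by fact
  interpret AA: comm_group "G\<lparr>carrier := A\<rparr>" by fact
  let ?N = "fact n :: int"
  have comm: "x \<otimes> y = y \<otimes> x" if "x \<in> A" "y \<in> A" for x y using AA.m_comm that by simp
  define V where "V = (\<lambda>a. a [^] ?N) ` A"
  have VA: "V \<subseteq> A" unfolding V_def using subgroup_int_pow_closed[OF A.subgroup_axioms] by blast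
  have V: "subgroup V G"
  proof (rule subgroupI)
    show "V \<subseteq> carrier G" using VA by auto
    show "V \<noteq> {}" unfolding V_def using A.one_closed by blast
    show "inv v \<in> V" if "v \<in> V" for v
      using that by (auto simp: V_def int_pow_inv[symmetric])
    show "v \<otimes> w \<in> V" if "v \<in> V" "w \<in> V" for v w
      using that int_pow_mult_distrib[OF comm] by (auto simp: V_def) (metis A.m_closed A.mem_carrier imageI)
  qed
  let ?\<theta> = "\<lambda>x. inv g \<otimes> x \<otimes> g"
  interpret \<theta>: group_hom G G ?\<theta>
    using conj_hom[OF g] by (simp add: group_hom_def group_hom_axioms_def is_group)
  have "\<exists>\<epsilon>\<in>{1, -1::int}. \<forall>v\<in>V. ?\<theta> v = v [^] \<epsilon>"
  proof (rule power_automorphism_sign[OF conj_hom[OF g] V])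
    show "v \<otimes> w = w \<otimes> v" if "v \<in> V" "w \<in> V" for v w using comm that VA by blast
    show "\<exists>i::int. ?\<theta> v = v [^] i" if "v \<in> V" for v
      using that conj_factorial_power[OF bound _ g] by (auto simp: V_def)
    show "\<exists>i::int. v = ?\<theta> v [^] i" if v: "v \<in> V" for v
    proof -
      have vc: "v \<in> carrier G" using v VA by auto
      obtain a where a: "a \<in> A" "v = a [^] ?N" using v unfolding V_def by blast
      \<comment> \<open>That \<open>v\<close> is a power of its conjugate by \<open>g\<close> is the power property of \<open>inv g\<close>, conjugated by \<open>g\<close>.\<close>
      obtain i :: int where "inv (inv g) \<otimes> v \<otimes> inv g = v [^] i"
        using conj_factorial_power[OF bound A.mem_carrier[OF a(1)] inv_closed[OF g]]
        unfolding a(2) by blast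
      then have "?\<theta> (g \<otimes> v \<otimes> inv g) = ?\<theta> (v [^] i)" using g by simp
      moreover have "?\<theta> (g \<otimes> v \<otimes> inv g) = v" using g vc by (simp add: m_assoc) (simp flip: m_assoc)
      moreover have "?\<theta> (v [^] i) = ?\<theta> v [^] i" using conj_int_pow[OF g vc] .
      ultimately show ?thesis by metis
    qed
    show "u [^] ?N \<in> V" using u(1) by (simp add: V_def)
    have "ord u = 0" "u \<in> carrier G" using u by auto
    then show "ord (u [^] ?N) = 0"
      using int_pow_eq_one_iff_zero[of u] by (auto simp: ord_eq_0 int_pow_pow simp flip: int_pow_int)
  qed
  then obtain \<epsilon> where \<epsilon>: "\<epsilon> \<in> {1, -1::int}" "\<And>v. v \<in> V \<Longrightarrow> ?\<theta> v = v [^] \<epsilon>" by blast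
  have "(?\<theta> a) [^] ?N = (a [^] ?N) [^] \<epsilon>" if "a \<in> A" for a
    using \<epsilon>(2)[of "a [^] ?N"] conj_int_pow[OF g, of a ?N] that by (simp add: V_def)
  then show ?thesis using \<epsilon>(1) by blast
qed

end

section \<open>The action on the quotient\<close>

text \<open>The amount by which conjugation by \<open>g\<close> fails to be the \<open>k\<close>-th power map on \<open>a\<close>. A subgroup that
  contains \<open>h\<close> contains the conjugate of \<open>h\<close> by \<open>g\<close> iff it contains the defect of \<open>h\<close>, and unlike
  conjugation itself, the defect takes its values in the group \<open>B\<close> of finite exponent if \<open>g\<close> acts on \<open>A/B\<close>
  as the \<open>k\<close>-th power map.\<close>
definition power_defect :: "('a, 'b) monoid_scheme \<Rightarrow> int \<Rightarrow> 'a \<Rightarrow> 'a \<Rightarrow> 'a" where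
  "power_defect G k g a = (inv\<^bsub>G\<^esub> g \<otimes>\<^bsub>G\<^esub> a \<otimes>\<^bsub>G\<^esub> g) \<otimes>\<^bsub>G\<^esub> inv\<^bsub>G\<^esub> (a [^]\<^bsub>G\<^esub> k)"

context group
begin

lemma carrier_quotient_group: "carrier (quotient_group G A B) = (\<lambda>a. B #> a) ` A"
  unfolding quotient_group_def carrier_FactGroup by simp

lemma inv_quotient_group:
  assumes "subgroup A G" "B \<lhd> G" "B \<subseteq> A" "a \<in> A"
  shows "inv\<^bsub>quotient_group G A B\<^esub> (B #> a) = B #> inv a"
proof -
  interpret B: normal B "G\<lparr>carrier := A\<rparr>"
    using normal_restrict_supergroup[OF assms(1,2,3)] .
  have "B #> a \<in> carrier (quotient_group G A B)" using assms(4) by (simp add: carrier_quotient_group)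
  then have "inv\<^bsub>quotient_group G A B\<^esub> (B #> a) = set_inv\<^bsub>G\<lparr>carrier := A\<rparr>\<^esub> (B #> a)"
    unfolding quotient_group_def by (rule B.inv_FactGroup)
  also have "\<dots> = B #> inv\<^bsub>G\<lparr>carrier := A\<rparr>\<^esub> a" using B.rcos_inv[of a] assms(4) by simp
  finally show ?thesis using m_inv_consistent[OF assms(1,4)] by simp
qed

lemma conjugate_coset_eq_power_coset_iff:
  assumes "B \<lhd> G" "g \<in> carrier G" "a \<in> carrier G"
  shows "conjugate_set G (B #> a) g = B #> (a [^] (k::int)) \<longleftrightarrow> power_defect G k g a \<in> B"
proof -
  interpret B: normal B G by fact
  have "conjugate_set G (B #> a) g = B #> (inv g \<otimes> a \<otimes> g)"
  proof
    show "conjugate_set G (B #> a) g \<subseteq> B #> (inv g \<otimes> a \<otimes> g)"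
    proof
      fix y assume "y \<in> conjugate_set G (B #> a) g"
      then obtain b where b: "b \<in> B" "y = inv g \<otimes> (b \<otimes> a) \<otimes> g"
        unfolding conjugate_set_eq r_coset_def by blast
      then have "y = (inv g \<otimes> b \<otimes> g) \<otimes> (inv g \<otimes> a \<otimes> g)"
        using assms(2,3) by (simp add: m_assoc) (simp flip: m_assoc)
      then show "y \<in> B #> (inv g \<otimes> a \<otimes> g)"
        unfolding r_coset_def using B.inv_op_closed1[OF assms(2) b(1)] by blast
    qed
    show "B #> (inv g \<otimes> a \<otimes> g) \<subseteq> conjugate_set G (B #> a) g"
    proof
      fix y assume "y \<in> B #> (inv g \<otimes> a \<otimes> g)"
      then obtain b where b: "b \<in> B" "y = b \<otimes> (inv g \<otimes> a \<otimes> g)" unfolding r_coset_def by blast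
      then have "y = inv g \<otimes> ((g \<otimes> b \<otimes> inv g) \<otimes> a) \<otimes> g"
        using assms(2,3) by (simp add: m_assoc) (simp flip: m_assoc)
      then show "y \<in> conjugate_set G (B #> a) g"
        unfolding conjugate_set_eq r_coset_def using B.inv_op_closed2[OF assms(2) b(1)] by blast
    qed
  qed
  moreover have "B #> x = B #> y \<longleftrightarrow> x \<otimes> inv y \<in> B" if "x \<in> carrier G" "y \<in> carrier G" for x y
    by (metis B.rcos_module repr_independence rcos_self B.subgroup_axioms that is_group)
  ultimately show ?thesis unfolding power_defect_def using assms(2,3) by simp
qed

lemma acts_as_identity_iff:
  assumes "subgroup A G" "B \<lhd> G" "g \<in> carrier G"
  shows "acts_as_identity G A B g \<longleftrightarrow> (\<forall>a\<in>A. power_defect G 1 g a \<in> B)"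
proof -
  have "conjugate_set G (B #> a) g = B #> a \<longleftrightarrow> power_defect G 1 g a \<in> B" if "a \<in> A" for a
    using conjugate_coset_eq_power_coset_iff[OF assms(2,3), of a 1] subgroup.mem_carrier[OF assms(1) that]
    by simp
  then show ?thesis unfolding acts_as_identity_def carrier_quotient_group by simp
qed

lemma acts_as_inversion_iff:
  assumes "subgroup A G" "B \<lhd> G" "B \<subseteq> A" "g \<in> carrier G"
  shows "acts_as_inversion G A B g \<longleftrightarrow> (\<forall>a\<in>A. power_defect G (-1) g a \<in> B)"
proof -
  have "conjugate_set G (B #> a) g = inv\<^bsub>quotient_group G A B\<^esub> (B #> a) \<longleftrightarrow> power_defect G (-1) g a \<in> B"
    if "a \<in> A" for a
    using conjugate_coset_eq_power_coset_iff[OF assms(2,4), of a "-1"] subgroup.mem_carrier[OF assms(1) that]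
      inv_quotient_group[OF assms(1-3) that] by (simp add: int_pow_neg)
  then show ?thesis unfolding acts_as_inversion_def carrier_quotient_group by simp
qed

text \<open>On an abelian normal subgroup, conjugation and the \<open>k\<close>-th power map are endomorphisms, and so is
  their quotient.\<close>
lemma power_defect_hom:
  assumes "A \<lhd> G" "comm_group (G\<lparr>carrier := A\<rparr>)" "g \<in> carrier G"
  shows "power_defect G k g \<in> hom (G\<lparr>carrier := A\<rparr>) (G\<lparr>carrier := A\<rparr>)"
proof -
  interpret A: normal A G by fact
  interpret AA: comm_group "G\<lparr>carrier := A\<rparr>" by fact
  have comm: "x \<otimes> y = y \<otimes> x" if "x \<in> A" "y \<in> A" for x y using AA.m_comm that by simp
  have lcomm: "x \<otimes> (y \<otimes> z) = y \<otimes> (x \<otimes> z)" if "x \<in> A" "y \<in> A" "z \<in> A" for x y z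
    using AA.m_lcomm that by simp
  have conj: "inv g \<otimes> a \<otimes> g \<in> A" if "a \<in> A" for a using A.inv_op_closed1 assms(3) that by blast
  have pow: "a [^] k \<in> A" if "a \<in> A" for a
    using subgroup_int_pow_closed[OF A.subgroup_axioms that] .
  show ?thesis
  proof (rule homI)
    fix a assume "a \<in> carrier (G\<lparr>carrier := A\<rparr>)"
    then show "power_defect G k g a \<in> carrier (G\<lparr>carrier := A\<rparr>)"
      unfolding power_defect_def using conj pow by simp
  next
    fix a b assume "a \<in> carrier (G\<lparr>carrier := A\<rparr>)" "b \<in> carrier (G\<lparr>carrier := A\<rparr>)"
    then have ab: "a \<in> A" "b \<in> A" by auto
    let ?x = "inv g \<otimes> a \<otimes> g" and ?y = "inv g \<otimes> b \<otimes> g"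
    have 1: "inv g \<otimes> (a \<otimes> b) \<otimes> g = ?x \<otimes> ?y"
      using hom_mult[OF conj_hom[OF assms(3)]] ab by simp
    have 2: "inv ((a \<otimes> b) [^] k) = inv (a [^] k) \<otimes> inv (b [^] k)"
      using int_pow_mult_distrib[OF comm[OF ab]] ab comm pow by (simp add: inv_mult_group)
    have "(?x \<otimes> ?y) \<otimes> (inv (a [^] k) \<otimes> inv (b [^] k)) = (?x \<otimes> inv (a [^] k)) \<otimes> (?y \<otimes> inv (b [^] k))"
      using lcomm[of ?y "inv (a [^] k)" "inv (b [^] k)"] conj ab pow by (simp add: m_assoc assms(3))
    then show "power_defect G k g (a \<otimes>\<^bsub>G\<lparr>carrier := A\<rparr>\<^esub> b) =
        power_defect G k g a \<otimes>\<^bsub>G\<lparr>carrier := A\<rparr>\<^esub> power_defect G k g b"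
      unfolding power_defect_def by (simp add: 1 2)
  qed
qed

end

section \<open>From an action by powers to bounded cores\<close>

context group
begin

text \<open>The core of \<open>H\<close> contains that of \<open>H \<inter> A\<close>, and \<open>|H : H \<inter> A| \<le> |G : A|\<close>.\<close>
lemma BCF_group_if_bounded_below_finite_index:
  assumes "subgroup A G" "covered_by_cosets G m (carrier G) A"
    and bound: "\<And>H. \<lbrakk>subgroup H G; H \<subseteq> A\<rbrakk> \<Longrightarrow> covered_by_cosets G n H (normal_core G H)"
  shows "BCF_group G"
  unfolding BCF_group_iff
proof (intro exI allI impI)
  fix H assume H: "subgroup H G"
  have sub: "subgroup (H \<inter> A) G" using subgroups_Inter_pair[OF H assms(1)] .
  have Hc: "H \<subseteq> carrier G" using subgroup.subset[OF H] .
  have "covered_by_cosets G (n * m) H (normal_core G (H \<inter> A))"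
    using covered_by_cosets_trans[OF covered_by_cosets_intersection[OF H assms(1,2)] bound[OF sub]] Hc
    by blast
  moreover have "normal_core G (H \<inter> A) \<subseteq> normal_core G H"
    using mem_normal_core_iff[OF Hc] mem_normal_core_iff[OF subgroup.subset[OF sub]] by blast
  ultimately show "covered_by_cosets G (n * m) H (normal_core G H)"
    using covered_by_cosets_mono by blast
qed

text \<open>The defect maps the core of \<open>H\<close> into \<open>H\<close>. So if the core has finite index in \<open>H\<close>, then the image of
  \<open>H\<close> under the defect meets only finitely many cosets of \<open>H\<close>. As \<open>B\<close> has finite exponent, their
  number is then bounded for all \<open>H\<close> together.\<close>
lemma bounded_power_defect_covering:
  assumes "CF_group G" "A \<lhd> G" "comm_group (G\<lparr>carrier := A\<rparr>)" "g \<in> carrier G"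
    and B: "B \<subseteq> A" "finite_exponent G B" "\<And>a. a \<in> A \<Longrightarrow> power_defect G k g a \<in> B"
  shows "\<exists>n. \<forall>H. subgroup H (G\<lparr>carrier := A\<rparr>) \<longrightarrow>
    covered_by_cosets (G\<lparr>carrier := A\<rparr>) n (power_defect G k g ` H) H"
proof -
  interpret A: normal A G by fact
  interpret AA: comm_group "G\<lparr>carrier := A\<rparr>" by fact
  note hom = power_defect_hom[OF assms(2-4), of k]
  obtain e :: nat where e: "e > 0" "\<And>b. b \<in> B \<Longrightarrow> b [^] e = \<one>"
    using B(2) unfolding finite_exponent_def by blast
  show ?thesis
  proof (rule AA.bounded_covering_if_finite_covering[OF hom e(1)])
    fix a assume "a \<in> carrier (G\<lparr>carrier := A\<rparr>)"
    then show "power_defect G k g a [^]\<^bsub>G\<lparr>carrier := A\<rparr>\<^esub> e = \<one>\<^bsub>G\<lparr>carrier := A\<rparr>\<^esub>"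
      using e(2) B(3) by (simp flip: nat_pow_consistent)
  next
    fix H assume H': "subgroup H (G\<lparr>carrier := A\<rparr>)"
    then have H: "subgroup H G" "H \<subseteq> A"
      using incl_subgroup[OF A.subgroup_axioms] subgroup.subset by force+
    let ?C = "normal_core G H"
    have C: "subgroup ?C G" "?C \<subseteq> H"
      using subgroup_normal_core[OF H(1)] normal_core_subset subgroup.subset[OF H(1)] by auto
    obtain n where "covered_by_cosets G n H ?C" using assms(1) H(1) CF_group_iff by blast
    then have "covered_by_cosets (G\<lparr>carrier := A\<rparr>) n H ?C"
      using covered_by_cosets_subgroup_iff[OF A.subgroup_axioms H(2) C(1)] C(2) H(2) by blast
    then have "covered_by_cosets (G\<lparr>carrier := A\<rparr>) n (power_defect G k g ` H) (power_defect G k g ` ?C)"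
      using AA.covered_by_cosets_image[OF AA.is_group hom] H(2) by simp
    moreover have "power_defect G k g ` ?C \<subseteq> H"
    proof
      fix y assume "y \<in> power_defect G k g ` ?C"
      then obtain c where c: "c \<in> ?C" "y = power_defect G k g c" by blast
      have "inv g \<otimes> c \<otimes> g \<in> H" using conj_mem_normal_core[OF H(1) c(1) assms(4)] C(2) by blast
      moreover have "inv (c [^] k) \<in> H"
        using subgroup_int_pow_closed[OF H(1)] subgroup.m_inv_closed[OF H(1)] c(1) C(2) by blast
      ultimately show "y \<in> H"
        unfolding c(2) power_defect_def by (rule subgroup.m_closed[OF H(1)])
    qed
    ultimately show "\<exists>n. covered_by_cosets (G\<lparr>carrier := A\<rparr>) n (power_defect G k g ` H) H"
      using AA.covered_by_cosets_mono by blast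
  qed
qed

text \<open>Conjugation on \<open>A\<close> by \<open>g\<close> depends only on the coset of \<open>A\<close> that contains \<open>g\<close>. Hence \<open>h \<in> H\<close> is in
  the core of \<open>H \<le> A\<close> as soon as \<open>H\<close> contains its defects for the finitely many representatives
  \<open>t\<close> of these cosets.\<close>
lemma BCF_group_if_power_action_modulo_finite_exponent:
  assumes "CF_group G" "A \<lhd> G" "comm_group (G\<lparr>carrier := A\<rparr>)"
    and "covered_by_cosets G m (carrier G) A"
    and B: "B \<subseteq> A" "finite_exponent G B"
    and act: "\<And>g. g \<in> carrier G \<Longrightarrow> \<exists>k. \<forall>a\<in>A. power_defect G k g a \<in> B"
  shows "BCF_group G"
proof -
  interpret A: normal A G by fact
  interpret AA: comm_group "G\<lparr>carrier := A\<rparr>" by fact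
  have comm: "x \<otimes> y = y \<otimes> x" if "x \<in> A" "y \<in> A" for x y using AA.m_comm that by simp
  obtain T where T: "T \<subseteq> carrier G" "finite T" "\<And>g. g \<in> carrier G \<Longrightarrow> \<exists>t\<in>T. g \<otimes> inv t \<in> A"
    using assms(4) unfolding covered_by_cosets_def by blast
  obtain k where k: "\<And>t a. \<lbrakk>t \<in> T; a \<in> A\<rbrakk> \<Longrightarrow> power_defect G (k t) t a \<in> B"
    using act T(1) by (metis subsetD)
  have "\<exists>n. \<forall>H. subgroup H (G\<lparr>carrier := A\<rparr>) \<longrightarrow>
    covered_by_cosets (G\<lparr>carrier := A\<rparr>) n H {h \<in> H. \<forall>t\<in>T. power_defect G (k t) t h \<in> H}"
  proof (rule AA.bounded_simultaneous_invariance[OF T(2)])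
    fix t assume t: "t \<in> T"
    then have tc: "t \<in> carrier G" using T(1) by blast
    show "power_defect G (k t) t \<in> hom (G\<lparr>carrier := A\<rparr>) (G\<lparr>carrier := A\<rparr>)"
      using power_defect_hom[OF assms(2,3) tc] .
    show "\<exists>n. \<forall>H. subgroup H (G\<lparr>carrier := A\<rparr>) \<longrightarrow>
      covered_by_cosets (G\<lparr>carrier := A\<rparr>) n (power_defect G (k t) t ` H) H"
      using bounded_power_defect_covering[OF assms(1-3) tc B k[OF t]] .
  qed
  then obtain n where n: "\<And>H. subgroup H (G\<lparr>carrier := A\<rparr>) \<Longrightarrow>
    covered_by_cosets (G\<lparr>carrier := A\<rparr>) n H {h \<in> H. \<forall>t\<in>T. power_defect G (k t) t h \<in> H}"
    by blast
  show ?thesis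
  proof (rule BCF_group_if_bounded_below_finite_index[OF A.subgroup_axioms assms(4)])
    fix H assume H: "subgroup H G" "H \<subseteq> A"
    interpret H: subgroup H G by fact
    let ?K = "{h \<in> H. \<forall>t\<in>T. power_defect G (k t) t h \<in> H}"
    have core: "subgroup (normal_core G H) G" "normal_core G H \<subseteq> H"
      using subgroup_normal_core[OF H(1)] normal_core_subset[OF H.subset] by auto
    have "?K \<subseteq> normal_core G H"
    proof
      fix h assume h: "h \<in> ?K"
      have hA: "h \<in> A" "h \<in> carrier G" using h H(2) by auto
      have "g \<otimes> h \<otimes> inv g \<in> H" if g: "g \<in> carrier G" for g
      proof -
        obtain t where t: "t \<in> T" "inv g \<otimes> inv t \<in> A" using T(3)[of "inv g"] g by auto
        then have tc: "t \<in> carrier G" using T(1) by blast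
        define a where "a = inv g \<otimes> inv t"
        have aA: "a \<in> A" "a \<in> carrier G" using t(2) by (auto simp: a_def)
        have "inv g = a \<otimes> t" unfolding a_def using g tc by (simp add: m_assoc)
        then have "g \<otimes> h \<otimes> inv g = inv t \<otimes> (inv a \<otimes> (h \<otimes> a)) \<otimes> t"
          using g tc aA hA by (metis inv_inv inv_mult_group m_assoc m_closed inv_closed)
        also have "inv a \<otimes> (h \<otimes> a) = h"
          using comm[OF hA(1) aA(1)] aA(2) hA(2) by (simp flip: m_assoc)
        also have "inv t \<otimes> h \<otimes> t = power_defect G (k t) t h \<otimes> h [^] (k t)"
          unfolding power_defect_def using tc hA(2) by (simp add: m_assoc)
        also have "\<dots> \<in> H"
          using h t(1) subgroup_int_pow_closed[OF H(1)] by simp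
        finally show ?thesis .
      qed
      then show "h \<in> normal_core G H" using mem_normal_core_iff[OF H.subset] hA(2) by blast
    qed
    then have "covered_by_cosets (G\<lparr>carrier := A\<rparr>) n H (normal_core G H)"
      using AA.covered_by_cosets_mono[OF n[OF subgroup_incl[OF H(1) A.subgroup_axioms H(2)]]] by blast
    then show "covered_by_cosets G n H (normal_core G H)"
      using covered_by_cosets_subgroup_iff[OF A.subgroup_axioms H(2) core(1)] core(2) H(2) by blast
  qed
qed

end

section \<open>The equivalence\<close>

theorem proposition3p2:
  fixes G :: "('a, 'b) monoid_scheme" and A :: "'a set"
  assumes "group G"
    and "\<not> periodic_group G"
    and "A \<lhd> G"
    and "comm_group (G\<lparr>carrier := A\<rparr>)"
    and "finite (rcosets\<^bsub>G\<^esub> A)"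
  shows "BCF_group G \<longleftrightarrow>
    CF_group G \<and>
    (\<exists>B. subgroup B G \<and> B \<subseteq> A \<and> finite_exponent G B \<and> B \<lhd> G \<and>
      (\<forall>g \<in> carrier G. acts_as_identity G A B g \<or> acts_as_inversion G A B g))"
proof -
  interpret group G by fact
  interpret A: normal A G by fact
  interpret AA: comm_group "G\<lparr>carrier := A\<rparr>" by fact
  have comm: "x \<otimes>\<^bsub>G\<^esub> y = y \<otimes>\<^bsub>G\<^esub> x" if "x \<in> A" "y \<in> A" for x y using AA.m_comm that by simp
  obtain m where m: "covered_by_cosets G m (carrier G) A"
    using cosets_in_card_iff[OF subgroup_self A.subgroup_axioms A.subset, of "card (rcosets\<^bsub>G\<^esub> A)"]
      assms(5) by (auto simp: cosets_in_def)
  show ?thesis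
  proof
    assume BCF: "BCF_group G"
    then obtain n where n: "\<And>H. subgroup H G \<Longrightarrow> covered_by_cosets G n H (normal_core G H)"
      using BCF_group_iff by blast
    have "CF_group G" using BCF by (auto simp: BCF_group_def CF_group_def)
    obtain x where x: "x \<in> carrier G" "ord x = 0" using assms(2) by (auto simp: periodic_group_def)
    obtain d :: nat where d: "0 < d" "x [^]\<^bsub>G\<^esub> d \<in> A"
      using exists_power_in_if_covered_by_cosets[OF m A.subgroup_axioms x(1)] x(1) by blast
    define u where "u = x [^]\<^bsub>G\<^esub> d"
    have u: "u \<in> A" "ord u = 0"
      using d x unfolding u_def by (auto simp: ord_eq_0 nat_pow_pow)
    let ?N = "fact n :: int"
    define B where "B = {a \<in> A. a [^]\<^bsub>G\<^esub> ?N = \<one>\<^bsub>G\<^esub>}"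
    have "subgroup B G"
    proof (rule subgroupI)
      show "B \<subseteq> carrier G" by (auto simp: B_def)
      have "\<one>\<^bsub>G\<^esub> \<in> B" by (simp add: B_def)
      then show "B \<noteq> {}" by blast
      show "inv\<^bsub>G\<^esub> a \<in> B" if "a \<in> B" for a using that by (auto simp: B_def int_pow_inv)
      show "a \<otimes>\<^bsub>G\<^esub> b \<in> B" if "a \<in> B" "b \<in> B" for a b
        using that int_pow_mult_distrib[OF comm] by (auto simp: B_def)
    qed
    have "B \<lhd> G"
      unfolding normal_inv_iff
    proof (intro conjI ballI)
      fix g a assume ga: "g \<in> carrier G" "a \<in> B"
      then have "g \<otimes>\<^bsub>G\<^esub> a \<otimes>\<^bsub>G\<^esub> inv\<^bsub>G\<^esub> g \<in> A" using A.inv_op_closed2 by (auto simp: B_def)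
      moreover have "(g \<otimes>\<^bsub>G\<^esub> a \<otimes>\<^bsub>G\<^esub> inv\<^bsub>G\<^esub> g) [^]\<^bsub>G\<^esub> ?N = \<one>\<^bsub>G\<^esub>"
        using conj_int_pow[of "inv\<^bsub>G\<^esub> g" a ?N] ga by (simp add: B_def)
      ultimately show "g \<otimes>\<^bsub>G\<^esub> a \<otimes>\<^bsub>G\<^esub> inv\<^bsub>G\<^esub> g \<in> B" by (simp add: B_def)
    qed fact
    have BA: "B \<subseteq> A" by (auto simp: B_def)
    have "finite_exponent G B"
      unfolding finite_exponent_def
      by (intro exI[of _ "fact n"]) (auto simp: B_def int_pow_int[symmetric])
    moreover have "acts_as_identity G A B g \<or> acts_as_inversion G A B g" if g: "g \<in> carrier G" for g
    proof -
      obtain \<epsilon> where \<epsilon>: "\<epsilon> \<in> {1, -1::int}"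
        "\<And>a. a \<in> A \<Longrightarrow> (inv\<^bsub>G\<^esub> g \<otimes>\<^bsub>G\<^esub> a \<otimes>\<^bsub>G\<^esub> g) [^]\<^bsub>G\<^esub> ?N = (a [^]\<^bsub>G\<^esub> ?N) [^]\<^bsub>G\<^esub> \<epsilon>"
        using sign_action_on_power_subgroup[OF n assms(3,4) u g] by blast
      have "power_defect G \<epsilon> g a \<in> B" if a: "a \<in> A" for a
      proof -
        let ?c = "inv\<^bsub>G\<^esub> g \<otimes>\<^bsub>G\<^esub> a \<otimes>\<^bsub>G\<^esub> g" and ?p = "inv\<^bsub>G\<^esub> (a [^]\<^bsub>G\<^esub> \<epsilon>)"
        have cp: "?c \<in> A" "?p \<in> A"
          using A.inv_op_closed1[OF g a] subgroup_int_pow_closed[OF A.subgroup_axioms a] by auto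
        then have "(?c \<otimes>\<^bsub>G\<^esub> ?p) [^]\<^bsub>G\<^esub> ?N = ?c [^]\<^bsub>G\<^esub> ?N \<otimes>\<^bsub>G\<^esub> ?p [^]\<^bsub>G\<^esub> ?N"
          using int_pow_mult_distrib[OF comm[OF cp]] by simp
        also have "?p [^]\<^bsub>G\<^esub> ?N = inv\<^bsub>G\<^esub> ((a [^]\<^bsub>G\<^esub> ?N) [^]\<^bsub>G\<^esub> \<epsilon>)"
          using a by (simp add: int_pow_inv int_pow_pow mult.commute)
        finally have "(?c \<otimes>\<^bsub>G\<^esub> ?p) [^]\<^bsub>G\<^esub> ?N = \<one>\<^bsub>G\<^esub>" using \<epsilon>(2)[OF a] a by simp
        then show ?thesis unfolding power_defect_def B_def using cp by simp
      qed
      then show ?thesis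
        using \<epsilon>(1) acts_as_identity_iff[OF A.subgroup_axioms \<open>B \<lhd> G\<close> g]
          acts_as_inversion_iff[OF A.subgroup_axioms \<open>B \<lhd> G\<close> BA g] by blast
    qed
    ultimately show "CF_group G \<and> (\<exists>B. subgroup B G \<and> B \<subseteq> A \<and> finite_exponent G B \<and> B \<lhd> G \<and>
      (\<forall>g \<in> carrier G. acts_as_identity G A B g \<or> acts_as_inversion G A B g))"
      using \<open>CF_group G\<close> \<open>subgroup B G\<close> \<open>B \<lhd> G\<close> BA by blast
  next
    assume "CF_group G \<and> (\<exists>B. subgroup B G \<and> B \<subseteq> A \<and> finite_exponent G B \<and> B \<lhd> G \<and>
      (\<forall>g \<in> carrier G. acts_as_identity G A B g \<or> acts_as_inversion G A B g))"
    then obtain B where CF: "CF_group G" and B: "B \<subseteq> A" "finite_exponent G B" "B \<lhd> G"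
      and act: "\<And>g. g \<in> carrier G \<Longrightarrow> acts_as_identity G A B g \<or> acts_as_inversion G A B g"
      by blast
    have "\<exists>k. \<forall>a\<in>A. power_defect G k g a \<in> B" if g: "g \<in> carrier G" for g
      using act[OF g] acts_as_identity_iff[OF A.subgroup_axioms B(3) g]
        acts_as_inversion_iff[OF A.subgroup_axioms B(3,1) g] by blast
    then show "BCF_group G"
      using BCF_group_if_power_action_modulo_finite_exponent[OF CF assms(3,4) m B(1,2)] by blast
  qed
qed

end
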